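(* Let $L=L_{-1}\oplus L_0$ be a strict Lie 2-algebra, let $\mathcal{M}=A[1]$ be an NQ-1 manifold with homological vector field $Q$, and let $\phi=(\mu,\eta):L\rightsquigarrow\chi(\mathcal{M})$ be an action of $L$ on $\mathcal{M}$. Put $$\mathcal{D}:=\mathrm{Span}_{C(\mathcal{M})}\{\mu(L),\ \eta(\wedge^2L_0),\ d_Q(\eta(\wedge^2L_0))\}\subset\chi(\mathcal{M}),$$ where $d_Q=[Q,\cdot]$. If $[\mathcal{D}_0,\mathcal{D}_{-1}]\subset\mathcal{D}_{-1}$, then i) $[Q,\mathcal{D}]\subset\mathcal{D}$; ii) $\mathcal{D}$ is involutive.
   Context: **NQ-1 manifolds.** For a vector bundle $A\to M$, $\mathcal{M}=A[1]$ is the N-manifold with body $M$ and functions $C(\mathcal{M})=\Gamma(\wedge^\bullet A^* )$; vector fields $\chi(\mathcal{M})$ are graded derivations of $C(\mathcal{M})$, with graded commutator $[\cdot,\cdot]$; they are concentrated in degrees $\ge-1$. An NQ-1 structure is a degree $1$ vector field $Q$ with $[Q,Q]=0$; then $(\chi(\mathcal{M}),d_Q=[Q,\cdot],[\cdot,\cdot])$ is a differential graded Lie algebra (DGLA). Equivalently, $A$ is a Lie algebroid with $[a,a']_A=[[Q,a],a']$, $\rho_A(a)f=[[Q,a],f]$ for $a,a'\in\Gamma(A)=\chi_{-1}(\mathcal{M})$. **Strict Lie 2-algebra.** A DGLA $(L,\delta,[\cdot,\cdot])$ concentrated in degrees $-1$ and $0$, with $\delta:L_{-1}\to L_0$ of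 degree $1$. **Action.** An action of a strict Lie 2-algebra $L$ on an NQ-1 manifold $\mathcal{M}$ is an $L_\infty$-morphism $\phi:L\rightsquigarrow(\chi(\mathcal{M}),d_Q,[\cdot,\cdot])$. Explicitly, it consists of linear maps $\mu:L_0\to\chi_0(\mathcal{M})$, $\mu:L_{-1}\to\chi_{-1}(\mathcal{M})$ and $\eta:\wedge^2L_0\to\chi_{-1}(\mathcal{M})$ such that for all $x,y,z\in L_0$, $w\in L_{-1}$: - $d_Q\mu=\mu\delta$ (in particular $[Q,\mu(x)]=0$ for $x\in L_0$), - $\mu[x,y]-[\mu x,\mu y]=d_Q(\eta(x\wedge y))$, - $\mu[w,x]-[\mu w,\mu x]=\eta(\delta w\wedge x)$, - $0=\eta(x\wedge[y,z])-\eta(y\wedge[x,z])+\eta(z\wedge[x,y])+[\mu(x),\eta(y\wedge z)]-[\mu(y),\eta(x\wedge z)]+[\mu(z),\eta(x\wedge y)]$. **Conventions.** $\mathcal{D}_i$ is the degree $i$ component of the graded $C(\mathcal{M})$-submodule $\mathcal{D}\subset\chi(\mathcal{M})$; $\mathcal{D}$ is called involutive if it is closed under the Lie bracket of vector fields on $\mathcal{M}$. *)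

theory Defs
  imports "HOL-Analysis.Analysis" "HOL-Library.Function_Algebras"
begin

section \<open>Smooth manifolds and vector bundles\<close>

primrec Ck_on :: "nat \<Rightarrow> 'e::real_normed_vector set \<Rightarrow> ('e \<Rightarrow> 'f::real_normed_vector) \<Rightarrow> bool" where
  "Ck_on 0 S f \<longleftrightarrow> continuous_on S f"
| "Ck_on (Suc k) S f \<longleftrightarrow>
     (\<forall>x\<in>S. f differentiable (at x)) \<and> (\<forall>v. Ck_on k S (\<lambda>x. frechet_derivative f (at x) v))"

text \<open>Only used for open sets \<open>S\<close>.\<close>

definition smooth_on :: "'e::real_normed_vector set \<Rightarrow> ('e \<Rightarrow> 'f::real_normed_vector) \<Rightarrow> bool" where
  "smooth_on S f \<longleftrightarrow> (\<forall>k. Ck_on k S f)"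

text \<open>
  A vector bundle \<open>A \<rightarrow> M\<close> of rank \<open>r\<close>. The manifold \<open>M\<close> is a topology with an atlas of
  charts \<open>(V, \<phi>)\<close>. The fibres \<open>A\<^sub>p\<close> are linear subspaces of an ambient real vector space,
  which plays no role beyond providing the vector space operations on each fibre (any
  family of vector spaces embeds into a common one). The bundle structure is given by local
  frames \<open>(U, e)\<close>, where \<open>e i p \<in> A\<^sub>p\<close> for \<open>i < r\<close> and \<open>p \<in> U\<close>, with smooth
  transition matrices.
\<close>

record ('m, 'e, 'a) vbundle =
  base :: "'m topology"
  charts :: "('m set \<times> ('m \<Rightarrow> 'e)) set"
  brank :: nat
  fibre :: "'m \<Rightarrow> 'a set"
  frames :: "('m set \<times> (nat \<Rightarrow> 'm \<Rightarrow> 'a)) set"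

text \<open>
  The sort of the model space \<open>'e\<close> of the charts describes exactly the finite-dimensional inner
  product spaces: the Heine-Borel property forces finite dimension. Unlike
  \<open>euclidean_space\<close>, whose basis is nonempty, it admits dimension 0, so that \<open>M\<close> may be a
  point and \<open>A\<close> a Lie algebra.
\<close>

definition smooth_manifold ::
    "('m, 'e::{real_inner,heine_borel}, 'a, 'z) vbundle_scheme \<Rightarrow> bool" where
  "smooth_manifold A \<longleftrightarrow>
     Hausdorff_space (base A) \<and> second_countable (base A) \<and>
     (\<Union>(V, \<phi>)\<in>charts A. V) = topspace (base A) \<and>
     (\<forall>(V, \<phi>)\<in>charts A. openin (base A) V \<and> open (\<phi> ` V) \<and>
        homeomorphic_map (subtopology (base A) V) (top_of_set (\<phi> ` V)) \<phi>) \<and>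
     (\<forall>(V, \<phi>)\<in>charts A. \<forall>(W, \<psi>)\<in>charts A. smooth_on (\<phi> ` (V \<inter> W)) (\<psi> \<circ> inv_into V \<phi>))"

text \<open>Smoothness of a real function on an open subset \<open>U\<close> of the base.\<close>

definition smooth_fun ::
    "('m, 'e::{real_inner,heine_borel}, 'a, 'z) vbundle_scheme \<Rightarrow> 'm set \<Rightarrow> ('m \<Rightarrow> real) \<Rightarrow> bool" where
  "smooth_fun A U f \<longleftrightarrow> (\<forall>(V, \<phi>)\<in>charts A. smooth_on (\<phi> ` (U \<inter> V)) (f \<circ> inv_into V \<phi>))"

definition vector_bundle ::
    "('m, 'e::{real_inner,heine_borel}, 'a::real_vector, 'z) vbundle_scheme \<Rightarrow> bool" where
  "vector_bundle A \<longleftrightarrow>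
     smooth_manifold A \<and>
     (\<Union>(U, e)\<in>frames A. U) = topspace (base A) \<and>
     (\<forall>(U, e)\<in>frames A. openin (base A) U \<and>
        (\<forall>p\<in>U. inj_on (\<lambda>i. e i p) {..<brank A} \<and>
                independent ((\<lambda>i. e i p) ` {..<brank A}) \<and>
                span ((\<lambda>i. e i p) ` {..<brank A}) = fibre A p)) \<and>
     (\<forall>(U, e)\<in>frames A. \<forall>(U', e')\<in>frames A. \<exists>g.
        (\<forall>i<brank A. \<forall>j<brank A. smooth_fun A (U \<inter> U') (g i j)) \<and>
        (\<forall>p\<in>U \<inter> U'. \<forall>j<brank A. e' j p = (\<Sum>i<brank A. g i j p *\<^sub>R e i p)))"

section \<open>Functions and vector fields on \<open>A[1]\<close>\<close>

text \<open>
  An element \<open>\<omega>\<close> of \<open>C(A[1]) = \<Gamma>(\<Lambda> A*)\<close> is represented by all its values: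
  \<open>\<omega> p [v\<^sub>1, \<dots>, v\<^sub>k]\<close> is the value at \<open>v\<^sub>1, \<dots>, v\<^sub>k \<in> A\<^sub>p\<close> of the component of \<open>\<omega>\<close> of
  degree \<open>k\<close>, which is an alternating \<open>k\<close>-linear form on \<open>A\<^sub>p\<close> depending smoothly on \<open>p\<close>.
  Since the rank is finite, components of degree above the rank vanish automatically and the
  direct sum over \<open>k\<close> needs no finiteness condition. Values at meaningless arguments are 0, so that
  equality of sections is equality of functions. Addition is pointwise.
\<close>

type_synonym ('m, 'a) form = "'m \<Rightarrow> 'a list \<Rightarrow> real"

definition alternating_forms :: "'a::real_vector set \<Rightarrow> ('a list \<Rightarrow> real) set" where
  "alternating_forms V = {\<alpha>.
     (\<forall>vs. \<not> set vs \<subseteq> V \<longrightarrow> \<alpha> vs = 0) \<and>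
     (\<forall>vs i u v. set vs \<subseteq> V \<and> i < length vs \<and> u \<in> V \<and> v \<in> V \<longrightarrow>
        \<alpha> (vs[i := u + v]) = \<alpha> (vs[i := u]) + \<alpha> (vs[i := v])) \<and>
     (\<forall>vs i u c. set vs \<subseteq> V \<and> i < length vs \<and> u \<in> V \<longrightarrow>
        \<alpha> (vs[i := c *\<^sub>R u]) = c * \<alpha> (vs[i := u])) \<and>
     (\<forall>vs i j. set vs \<subseteq> V \<and> i < j \<and> j < length vs \<and> vs ! i = vs ! j \<longrightarrow> \<alpha> vs = 0)}"

definition forms ::
    "('m, 'e::{real_inner,heine_borel}, 'a::real_vector, 'z) vbundle_scheme \<Rightarrow> ('m, 'a) form set" where
  "forms A = {\<omega>.
     (\<forall>p. p \<notin> topspace (base A) \<longrightarrow> \<omega> p = (\<lambda>_. 0)) \<and>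
     (\<forall>p\<in>topspace (base A). \<omega> p \<in> alternating_forms (fibre A p)) \<and>
     (\<forall>(U, e)\<in>frames A. \<forall>ks. set ks \<subseteq> {..<brank A} \<longrightarrow>
        smooth_fun A U (\<lambda>p. \<omega> p (map (\<lambda>i. e i p) ks)))}"

definition component :: "int \<Rightarrow> ('m, 'a) form \<Rightarrow> ('m, 'a) form" where
  "component k \<omega> = (\<lambda>p vs. if int (length vs) = k then \<omega> p vs else 0)"

definition forms_deg ::
    "('m, 'e::{real_inner,heine_borel}, 'a::real_vector, 'z) vbundle_scheme \<Rightarrow> int \<Rightarrow> ('m, 'a) form set" where
  "forms_deg A k = {\<omega> \<in> forms A. component k \<omega> = \<omega>}"

text \<open>
  The wedge product as a sum over shuffles: \<open>S\<close> is the set of positions of the arguments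
  fed to \<open>\<alpha>\<close>, and the sign is that of the corresponding shuffle. There is no factorial
  normalisation, so \<open>(\<alpha> \<and> \<beta>)(v, w) = \<alpha>(v) \<beta>(w) - \<alpha>(w) \<beta>(v)\<close> for \<open>\<alpha>, \<beta>\<close> of degree 1.
\<close>

definition wedge :: "('m, 'a) form \<Rightarrow> ('m, 'a) form \<Rightarrow> ('m, 'a) form" where
  "wedge \<alpha> \<beta> = (\<lambda>p vs. \<Sum>S\<in>Pow {..<length vs}.
     (-1) ^ card {(i, j). i \<in> S \<and> j \<in> {..<length vs} - S \<and> j < i} *
       \<alpha> p (nths vs S) * \<beta> p (nths vs ({..<length vs} - S)))"

text \<open>
  Vector fields are operators on \<open>C(A[1])\<close>, extended by 0 to non-elements of \<open>C(A[1])\<close>; sums of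
  operators are pointwise. The set \<open>vector_fields A d\<close> consists of the graded derivations of degree
  \<open>d\<close>; inhomogeneous vector fields are sums of such operators.
\<close>

type_synonym ('m, 'a) operator = "('m, 'a) form \<Rightarrow> ('m, 'a) form"

definition vector_fields ::
    "('m, 'e::{real_inner,heine_borel}, 'a::real_vector, 'z) vbundle_scheme \<Rightarrow> int \<Rightarrow> ('m, 'a) operator set" where
  "vector_fields A d = {X.
     (\<forall>\<omega>. \<omega> \<notin> forms A \<longrightarrow> X \<omega> = 0) \<and>
     (\<forall>\<alpha>\<in>forms A. \<forall>\<beta>\<in>forms A. X (\<alpha> + \<beta>) = X \<alpha> + X \<beta>) \<and>
     (\<forall>\<alpha>\<in>forms A. \<forall>c::real. X (\<lambda>p vs. c * \<alpha> p vs) = (\<lambda>p vs. c * X \<alpha> p vs)) \<and>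
     (\<forall>k. \<forall>\<alpha>\<in>forms_deg A k. X \<alpha> \<in> forms_deg A (k + d)) \<and>
     (\<forall>k. \<forall>\<alpha>\<in>forms_deg A k. \<forall>\<beta>\<in>forms A.
        X (wedge \<alpha> \<beta>) = wedge (X \<alpha>) \<beta> + (\<lambda>p vs. (-1) powi (d * k) * wedge \<alpha> (X \<beta>) p vs))}"

text \<open>Component of degree \<open>d\<close> of a possibly inhomogeneous linear operator.\<close>

definition op_component ::
    "('m, 'e::{real_inner,heine_borel}, 'a::real_vector, 'z) vbundle_scheme \<Rightarrow>
     int \<Rightarrow> ('m, 'a) operator \<Rightarrow> ('m, 'a) operator" where
  "op_component A d X = (\<lambda>\<omega>. if \<omega> \<in> forms A
     then (\<lambda>p vs. X (component (int (length vs) - d) \<omega>) p vs) else 0)"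

text \<open>
  The graded commutator, i.e. the biadditive extension of
  \<open>[X, Y] = X Y - (-1)^(|X| |Y|) Y X\<close> from homogeneous to arbitrary \<open>X\<close> and \<open>Y\<close>.
  Since \<open>C(A[1])\<close> is concentrated in degrees \<open>0, \<dots>, r\<close> with \<open>r\<close> the rank of \<open>A\<close>, components
  of operators of degree outside \<open>-r, \<dots>, r\<close> vanish.
\<close>

definition bracket ::
    "('m, 'e::{real_inner,heine_borel}, 'a::real_vector, 'z) vbundle_scheme \<Rightarrow>
     ('m, 'a) operator \<Rightarrow> ('m, 'a) operator \<Rightarrow> ('m, 'a) operator" where
  "bracket A X Y =
     (let r = int (brank A) in
      \<Sum>i\<in>{-r..r}. \<Sum>j\<in>{-r..r}. (\<lambda>\<omega> p vs.
        op_component A i X (op_component A j Y \<omega>) p vs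
        - (-1) powi (i * j) * op_component A j Y (op_component A i X \<omega>) p vs))"

definition NQ1_structure ::
    "('m, 'e::{real_inner,heine_borel}, 'a::real_vector, 'z) vbundle_scheme \<Rightarrow> ('m, 'a) operator \<Rightarrow> bool" where
  "NQ1_structure A Q \<longleftrightarrow> Q \<in> vector_fields A 1 \<and> bracket A Q Q = 0"

text \<open>The \<open>C(A[1])\<close>-submodule of the vector fields generated by \<open>S\<close>.\<close>

inductive_set module_span ::
    "('m, 'e::{real_inner,heine_borel}, 'a::real_vector, 'z) vbundle_scheme \<Rightarrow>
     ('m, 'a) operator set \<Rightarrow> ('m, 'a) operator set"
  for A and S where
  zero: "0 \<in> module_span A S"
| step: "f \<in> forms A \<Longrightarrow> X \<in> S \<Longrightarrow> Y \<in> module_span A S \<Longrightarrow>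
           (\<lambda>\<omega>. wedge f (X \<omega>)) + Y \<in> module_span A S"

definition degree_part ::
    "('m, 'e::{real_inner,heine_borel}, 'a::real_vector, 'z) vbundle_scheme \<Rightarrow>
     ('m, 'a) operator set \<Rightarrow> int \<Rightarrow> ('m, 'a) operator set" where
  "degree_part A D i = D \<inter> vector_fields A i"

definition involutive ::
    "('m, 'e::{real_inner,heine_borel}, 'a::real_vector, 'z) vbundle_scheme \<Rightarrow>
     ('m, 'a) operator set \<Rightarrow> bool" where
  "involutive A D \<longleftrightarrow> (\<forall>X\<in>D. \<forall>Y\<in>D. bracket A X Y \<in> D)"

section \<open>Strict Lie 2-algebras and their actions\<close>

text \<open>The underlying vector space of a DGLA is a whole type, graded by subspaces \<open>grade L i\<close>.\<close>

record 'l dgla =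
  grade :: "int \<Rightarrow> 'l set"
  lbr :: "'l \<Rightarrow> 'l \<Rightarrow> 'l"
  ldiff :: "'l \<Rightarrow> 'l"

definition DGLA :: "('l::real_vector, 'z) dgla_scheme \<Rightarrow> bool" where
  "DGLA L \<longleftrightarrow>
     (\<forall>i. subspace (grade L i)) \<and>
     (\<forall>x. \<exists>!c. (\<forall>i. c i \<in> grade L i) \<and> finite {i. c i \<noteq> 0} \<and> x = (\<Sum>i | c i \<noteq> 0. c i)) \<and>
     (\<forall>x. linear (lbr L x)) \<and> (\<forall>y. linear (\<lambda>x. lbr L x y)) \<and> linear (ldiff L) \<and>
     (\<forall>i j. \<forall>x\<in>grade L i. \<forall>y\<in>grade L j. lbr L x y \<in> grade L (i + j)) \<and>
     (\<forall>i. \<forall>x\<in>grade L i. ldiff L x \<in> grade L (i + 1)) \<and>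
     (\<forall>i j. \<forall>x\<in>grade L i. \<forall>y\<in>grade L j.
        lbr L x y = - (((-1) powi (i * j)) *\<^sub>R lbr L y x)) \<and>
     (\<forall>i j k. \<forall>x\<in>grade L i. \<forall>y\<in>grade L j. \<forall>z\<in>grade L k.
        lbr L x (lbr L y z) = lbr L (lbr L x y) z + ((-1) powi (i * j)) *\<^sub>R lbr L y (lbr L x z)) \<and>
     (\<forall>x. ldiff L (ldiff L x) = 0) \<and>
     (\<forall>i. \<forall>x\<in>grade L i. \<forall>y.
        ldiff L (lbr L x y) = lbr L (ldiff L x) y + ((-1) powi i) *\<^sub>R lbr L x (ldiff L y))"

definition strict_Lie_2_algebra :: "('l::real_vector, 'z) dgla_scheme \<Rightarrow> bool" where
  "strict_Lie_2_algebra L \<longleftrightarrow> DGLA L \<and> (\<forall>i. i \<noteq> -1 \<and> i \<noteq> 0 \<longrightarrow> grade L i = {0})"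

text \<open>
  The map \<open>\<eta>\<close> on the exterior square of \<open>L\<^sub>0\<close> is given as an alternating bilinear map on \<open>L\<^sub>0\<close>, so
  \<open>\<eta> x y\<close> stands for \<open>\<eta>(x \<and> y)\<close>; its values outside \<open>L\<^sub>0\<close> are irrelevant.
\<close>

definition action ::
    "('m, 'e::{real_inner,heine_borel}, 'a::real_vector, 'z) vbundle_scheme \<Rightarrow> ('m, 'a) operator \<Rightarrow>
     ('l::real_vector, 'w) dgla_scheme \<Rightarrow>
     ('l \<Rightarrow> ('m, 'a) operator) \<Rightarrow> ('l \<Rightarrow> 'l \<Rightarrow> ('m, 'a) operator) \<Rightarrow> bool" where
  "action A Q L \<mu> \<eta> \<longleftrightarrow>
     (\<forall>x y. \<mu> (x + y) = \<mu> x + \<mu> y) \<and>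
     (\<forall>c x. \<mu> (c *\<^sub>R x) = (\<lambda>\<omega> p vs. c * \<mu> x \<omega> p vs)) \<and>
     (\<forall>x\<in>grade L 0. \<mu> x \<in> vector_fields A 0) \<and>
     (\<forall>w\<in>grade L (-1). \<mu> w \<in> vector_fields A (-1)) \<and>
     (\<forall>x\<in>grade L 0. \<forall>y\<in>grade L 0. \<eta> x y \<in> vector_fields A (-1)) \<and>
     (\<forall>x\<in>grade L 0. \<eta> x x = 0) \<and>
     (\<forall>x\<in>grade L 0. \<forall>y\<in>grade L 0. \<forall>z\<in>grade L 0.
        \<eta> (x + y) z = \<eta> x z + \<eta> y z \<and> \<eta> z (x + y) = \<eta> z x + \<eta> z y) \<and>
     (\<forall>c. \<forall>x\<in>grade L 0. \<forall>y\<in>grade L 0.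
        \<eta> (c *\<^sub>R x) y = (\<lambda>\<omega> p vs. c * \<eta> x y \<omega> p vs) \<and>
        \<eta> x (c *\<^sub>R y) = (\<lambda>\<omega> p vs. c * \<eta> x y \<omega> p vs)) \<and>
     (\<forall>x. bracket A Q (\<mu> x) = \<mu> (ldiff L x)) \<and>
     (\<forall>x\<in>grade L 0. \<forall>y\<in>grade L 0.
        \<mu> (lbr L x y) - bracket A (\<mu> x) (\<mu> y) = bracket A Q (\<eta> x y)) \<and>
     (\<forall>w\<in>grade L (-1). \<forall>x\<in>grade L 0.
        \<mu> (lbr L w x) - bracket A (\<mu> w) (\<mu> x) = \<eta> (ldiff L w) x) \<and>
     (\<forall>x\<in>grade L 0. \<forall>y\<in>grade L 0. \<forall>z\<in>grade L 0.
        0 = \<eta> x (lbr L y z) - \<eta> y (lbr L x z) + \<eta> z (lbr L x y)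
            + bracket A (\<mu> x) (\<eta> y z) - bracket A (\<mu> y) (\<eta> x z) + bracket A (\<mu> z) (\<eta> x y))"

text \<open>
  The submodule \<open>\<D>\<close>. The elements \<open>\<eta> x y\<close> span the image of \<open>\<eta>\<close> over the reals, so they generate
  the same \<open>C(A[1])\<close>-module as that image.
\<close>

definition distribution ::
    "('m, 'e::{real_inner,heine_borel}, 'a::real_vector, 'z) vbundle_scheme \<Rightarrow> ('m, 'a) operator \<Rightarrow>
     ('l::real_vector, 'w) dgla_scheme \<Rightarrow>
     ('l \<Rightarrow> ('m, 'a) operator) \<Rightarrow> ('l \<Rightarrow> 'l \<Rightarrow> ('m, 'a) operator) \<Rightarrow> ('m, 'a) operator set" where
  "distribution A Q L \<mu> \<eta> = module_span A
     (range \<mu> \<union> {\<eta> x y |x y. x \<in> grade L 0 \<and> y \<in> grade L 0}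
       \<union> {bracket A Q (\<eta> x y) |x y. x \<in> grade L 0 \<and> y \<in> grade L 0})"

end

theory Submission
  imports Defs
begin

text \<open>
  By the Leibniz rule for the bracket, both claims need only be checked on the homogeneous
  generators \<open>\<mu>(L\<^sub>0)\<close>, \<open>[Q, \<eta>]\<close> (degree 0) and \<open>\<mu>(L\<^sub>-\<^sub>1)\<close>, \<open>\<eta>\<close> (degree -1). The
  generators of degree 0 commute with \<open>Q\<close>, because \<open>\<delta>\<close> vanishes on \<open>L\<^sub>0\<close> and \<open>[Q, Q] = 0\<close>.
  Hence \<open>[X, [Q, \<eta>]] = [Q, [X, \<eta>]]\<close> for such \<open>X\<close>, which lies in \<open>\<D>\<close> by the hypothesis on
  \<open>[\<D>\<^sub>0, \<D>\<^sub>-\<^sub>1]\<close> and by i); the remaining bracket \<open>[\<mu> x, \<mu> y]\<close> is given by the action.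
  Brackets of two generators of degree -1 have degree -2 and therefore vanish. That last fact is
  local: after multiplication by the square of a bump function, a form is a sum of products of a
  1-form with a form of lower degree.
\<close>

section \<open>The wedge product at a point\<close>

text \<open>Forms are functions on argument lists with the shuffle product, and vector fields are
  bare operators on global forms. The laws of the graded algebra are therefore proved at one point,
  by peeling off the first argument: contraction is an antiderivation, and this recursion takes care
  of the shuffle signs. Two further obstacles shape the proof. Elements of \<open>D\<close> need not
  be homogeneous while the Leibniz rule carries a sign depending on degrees, so \<open>D\<close> is
  rewritten as the span of homogeneous generators and coefficients are split by degree. And a
  derivation of degree -2 comes without coordinates: it kills functions and 1-forms because their
  images have negative degree, but a global form is not visibly a sum of products of such forms. The
  identity expressing k times a k-form as the sum of dual frame covectors wedged with contractions
  by the frame supplies the products locally. The covectors and the contractions both have to be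
  extended by zero, so each takes one factor of the bump function; hence its square.\<close>

definition lwedge :: "('a list \<Rightarrow> real) \<Rightarrow> ('a list \<Rightarrow> real) \<Rightarrow> 'a list \<Rightarrow> real" where
  "lwedge \<alpha> \<beta> vs = (\<Sum>S\<in>Pow {..<length vs}.
     (-1) ^ card {(i, j). i \<in> S \<and> j \<in> {..<length vs} - S \<and> j < i} *
       \<alpha> (nths vs S) * \<beta> (nths vs ({..<length vs} - S)))"

definition contract :: "'a \<Rightarrow> ('a list \<Rightarrow> real) \<Rightarrow> 'a list \<Rightarrow> real" where
  "contract v \<alpha> vs = \<alpha> (v # vs)"

text \<open>The parity automorphism, (-1)^k in degree k. Writing signs through it keeps the product
  rules valid for forms that are not homogeneous.\<close>

definition parity_twist :: "('a list \<Rightarrow> real) \<Rightarrow> 'a list \<Rightarrow> real" where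
  "parity_twist \<alpha> vs = (-1) ^ length vs * \<alpha> vs"

lemma wedge_eq_lwedge: "wedge \<alpha> \<beta> p = lwedge (\<alpha> p) (\<beta> p)"
  by (simp add: wedge_def lwedge_def fun_eq_iff)

lemma lwedge_Nil [simp]: "lwedge \<alpha> \<beta> [] = \<alpha> [] * \<beta> []"
  by (simp add: lwedge_def)

text \<open>Index sets of shuffles, sorted by whether the first argument goes to the left or to the
  right factor.\<close>

lemma Pow_lessThan_Suc_eq_Un_images:
  "Pow {..<Suc n} = (\<lambda>T. insert 0 (Suc ` T)) ` Pow {..<n} \<union> (`) Suc ` Pow {..<n}"
proof (intro equalityI subsetI)
  fix S assume S: "S \<in> Pow {..<Suc n}"
  define T where "T = {j. Suc j \<in> S}"
  have T: "T \<in> Pow {..<n}" using S by (auto simp: T_def)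
  have "S = (if 0 \<in> S then insert 0 (Suc ` T) else Suc ` T)"
  proof (rule set_eqI)
    fix x show "x \<in> S \<longleftrightarrow> x \<in> (if 0 \<in> S then insert 0 (Suc ` T) else Suc ` T)"
      by (cases x) (auto simp: T_def)
  qed
  then show "S \<in> (\<lambda>T. insert 0 (Suc ` T)) ` Pow {..<n} \<union> (`) Suc ` Pow {..<n}"
    using T by (cases "0 \<in> S") auto
qed auto

text \<open>Contraction is an antiderivation. A first argument given to \<alpha> creates no
  inversion; given to \<beta>, it is passed by every argument of \<alpha>, and that sign is the
  parity twist. Associativity and graded commutativity follow from this recursion.\<close>

lemma lwedge_Cons:
  "lwedge \<alpha> \<beta> (v # vs) =
     lwedge (contract v \<alpha>) \<beta> vs + lwedge (parity_twist \<alpha>) (contract v \<beta>) vs"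
proof -
  let ?n = "length vs"
  let ?inv = "\<lambda>n S. {(i, j). i \<in> S \<and> j \<in> {..<n} - S \<and> j < i}"
  let ?t = "\<lambda>S. (-1) ^ card (?inv (Suc ?n) S) * \<alpha> (nths (v # vs) S) *
                  \<beta> (nths (v # vs) ({..<Suc ?n} - S))"
  have inj1: "inj_on (\<lambda>T. insert 0 (Suc ` T)) (Pow {..<?n})"
  proof (rule inj_onI)
    fix S T :: "nat set"
    assume "insert 0 (Suc ` S) = insert 0 (Suc ` T)"
    then have "Suc ` S = Suc ` T" by (metis Diff_insert_absorb image_iff nat.distinct(1))
    then show "S = T" by (simp add: inj_image_eq_iff)
  qed
  have inj2: "inj_on ((`) Suc) (Pow {..<?n})"
    by (simp add: inj_on_def inj_image_eq_iff)
  have disj: "(\<lambda>T. insert 0 (Suc ` T)) ` Pow {..<?n} \<inter> (`) Suc ` Pow {..<?n} = {}"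
    by auto
  have t1: "?t (insert 0 (Suc ` T)) = (-1) ^ card (?inv ?n T) * contract v \<alpha> (nths vs T) *
      \<beta> (nths vs ({..<?n} - T))" if "T \<subseteq> {..<?n}" for T
  proof -
    \<comment> \<open>Position 0 lies in the set and nothing precedes it, so the inversions are
      those of \<open>T\<close>, shifted.\<close>
    have "?inv (Suc ?n) (insert 0 (Suc ` T)) = map_prod Suc Suc ` ?inv ?n T"
    proof (intro equalityI subsetI)
      fix x assume "x \<in> ?inv (Suc ?n) (insert 0 (Suc ` T))"
      then obtain i j where x: "x = (i, j)" "i \<in> insert 0 (Suc ` T)" "j < Suc ?n"
        "j \<notin> insert 0 (Suc ` T)" "j < i" by auto
      then obtain i' j' where "i = Suc i'" "j = Suc j'"
        by (metis insertI1 less_nat_zero_code old.nat.exhaust)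
      then show "x \<in> map_prod Suc Suc ` ?inv ?n T" using x
        by (auto intro!: image_eqI[of _ _ "(i', j')"])
    qed auto
    then have "card (?inv (Suc ?n) (insert 0 (Suc ` T))) = card (?inv ?n T)"
      by (simp add: card_image inj_on_def)
    moreover have "{j. Suc j \<in> insert 0 (Suc ` T)} = T" by auto
    moreover have "{j. Suc j \<in> {..<Suc ?n} - insert 0 (Suc ` T)} = {..<?n} - T" by auto
    ultimately show ?thesis by (simp add: nths_Cons contract_def)
  qed
  have t2: "?t (Suc ` T) = (-1) ^ card (?inv ?n T) * parity_twist \<alpha> (nths vs T) *
      contract v \<beta> (nths vs ({..<?n} - T))" if T: "T \<subseteq> {..<?n}" for T
  proof -
    have fin: "finite T" using T finite_subset by blast
    \<comment> \<open>Position 0 now lies in the complement and is inverted with every shifted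
      element of \<open>T\<close>: \<open>card T\<close> further sign changes, the length of the
      list fed to \<alpha>.\<close>
    have "?inv (Suc ?n) (Suc ` T) = map_prod Suc Suc ` ?inv ?n T \<union> (\<lambda>i. (Suc i, 0)) ` T"
    proof (intro equalityI subsetI)
      fix x assume "x \<in> ?inv (Suc ?n) (Suc ` T)"
      then obtain i j where x: "x = (Suc i, j)" "i \<in> T" "j < Suc ?n"
        "j \<notin> Suc ` T" "j < Suc i" by auto
      then show "x \<in> map_prod Suc Suc ` ?inv ?n T \<union> (\<lambda>i. (Suc i, 0)) ` T"
        by (cases j) (auto intro!: image_eqI[of _ _ "(i, j - 1)"])
    qed auto
    moreover have "finite (?inv ?n T)"
      by (rule finite_subset[of _ "T \<times> {..<?n}"]) (use fin in auto)
    moreover have "map_prod Suc Suc ` ?inv ?n T \<inter> (\<lambda>i. (Suc i, 0)) ` T = {}" by auto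
    ultimately have "card (?inv (Suc ?n) (Suc ` T)) = card (?inv ?n T) + card T"
      using fin by (simp add: card_Un_disjoint card_image inj_on_def)
    moreover have "{j. j < ?n \<and> j \<in> T} = T" using T by auto
    moreover have "{j. Suc j \<in> Suc ` T} = T" by auto
    moreover have "{j. Suc j \<in> {..<Suc ?n} - Suc ` T} = {..<?n} - T" by auto
    ultimately show ?thesis
      by (simp add: nths_Cons contract_def parity_twist_def length_nths power_add)
  qed
  have "lwedge \<alpha> \<beta> (v # vs) = (\<Sum>S\<in>Pow {..<Suc ?n}. ?t S)"
    by (simp add: lwedge_def)
  also have "\<dots> = (\<Sum>T\<in>Pow {..<?n}. ?t (insert 0 (Suc ` T))) + (\<Sum>T\<in>Pow {..<?n}. ?t (Suc ` T))"
    unfolding Pow_lessThan_Suc_eq_Un_images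
    by (subst sum.union_disjoint[OF _ _ disj])
      (simp_all only: finite_imageI finite_Pow_iff finite_lessThan sum.reindex[OF inj1]
        sum.reindex[OF inj2] o_def)
  also have "(\<Sum>T\<in>Pow {..<?n}. ?t (insert 0 (Suc ` T))) = lwedge (contract v \<alpha>) \<beta> vs"
    unfolding lwedge_def by (intro sum.cong refl t1) auto
  also have "(\<Sum>T\<in>Pow {..<?n}. ?t (Suc ` T)) = lwedge (parity_twist \<alpha>) (contract v \<beta>) vs"
    unfolding lwedge_def by (intro sum.cong refl t2) auto
  finally show ?thesis .
qed

lemma lwedge_add_left: "lwedge (\<alpha> + \<alpha>') \<beta> = lwedge \<alpha> \<beta> + lwedge \<alpha>' \<beta>"
  by (simp add: lwedge_def fun_eq_iff algebra_simps sum.distrib)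

lemma lwedge_add_right: "lwedge \<alpha> (\<beta> + \<beta>') = lwedge \<alpha> \<beta> + lwedge \<alpha> \<beta>'"
  by (simp add: lwedge_def fun_eq_iff algebra_simps sum.distrib)

lemma lwedge_scale_left: "lwedge (\<lambda>vs. c * \<alpha> vs) \<beta> = (\<lambda>vs. c * lwedge \<alpha> \<beta> vs)"
  by (simp add: lwedge_def fun_eq_iff algebra_simps sum_distrib_left)

lemma lwedge_scale_right: "lwedge \<alpha> (\<lambda>vs. c * \<beta> vs) = (\<lambda>vs. c * lwedge \<alpha> \<beta> vs)"
  by (simp add: lwedge_def fun_eq_iff algebra_simps sum_distrib_left)

lemma lwedge_zero_left [simp]: "lwedge (\<lambda>_. 0) \<beta> = (\<lambda>_. 0)"
  and lwedge_zero_right [simp]: "lwedge \<alpha> (\<lambda>_. 0) = (\<lambda>_. 0)"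
  by (simp_all add: lwedge_def fun_eq_iff)

lemma contract_lwedge:
  "contract v (lwedge \<alpha> \<beta>) = lwedge (contract v \<alpha>) \<beta> + lwedge (parity_twist \<alpha>) (contract v \<beta>)"
  by (simp add: fun_eq_iff contract_def[of v "lwedge \<alpha> \<beta>"] lwedge_Cons)

lemma contract_parity_twist:
  "contract v (parity_twist \<alpha>) = (\<lambda>vs. - 1 * parity_twist (contract v \<alpha>) vs)"
  by (simp add: fun_eq_iff contract_def parity_twist_def)

lemma parity_twist_twice [simp]: "parity_twist (parity_twist \<alpha>) = \<alpha>"
  by (simp add: fun_eq_iff parity_twist_def flip: mult.assoc power_add)

text \<open>Degrees add under the product. In the induction this comes down to the twist
  anticommuting with every contraction.\<close>

lemma parity_twist_lwedge: "parity_twist (lwedge \<alpha> \<beta>) = lwedge (parity_twist \<alpha>) (parity_twist \<beta>)"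
proof
  fix vs show "parity_twist (lwedge \<alpha> \<beta>) vs = lwedge (parity_twist \<alpha>) (parity_twist \<beta>) vs"
  proof (induction vs arbitrary: \<alpha> \<beta>)
    case Nil
    show ?case by (simp add: parity_twist_def)
  next
    case (Cons v vs)
    have "parity_twist (lwedge \<alpha> \<beta>) (v # vs) =
        - parity_twist (lwedge (contract v \<alpha>) \<beta>) vs
        - parity_twist (lwedge (parity_twist \<alpha>) (contract v \<beta>)) vs"
      by (simp add: parity_twist_def lwedge_Cons algebra_simps)
    then show ?case
      by (simp only: Cons.IH lwedge_Cons contract_parity_twist lwedge_scale_left lwedge_scale_right)
  qed
qed

text \<open>By the recursion both sides become the same three terms, in which the first argument
  goes to \<alpha>, \<beta> or \<gamma>.\<close>

lemma lwedge_assoc: "lwedge (lwedge \<alpha> \<beta>) \<gamma> = lwedge \<alpha> (lwedge \<beta> \<gamma>)"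
proof
  fix vs show "lwedge (lwedge \<alpha> \<beta>) \<gamma> vs = lwedge \<alpha> (lwedge \<beta> \<gamma>) vs"
    by (induction vs arbitrary: \<alpha> \<beta> \<gamma>)
      (simp_all add: lwedge_Cons contract_lwedge parity_twist_lwedge lwedge_add_left lwedge_add_right)
qed

text \<open>Only \<alpha> has to be homogeneous: moving it past the degree l part of \<beta> costs
  (-1)^(k l), which is the effect of \<open>k\<close> twists of \<beta> for every l at once.\<close>

lemma lwedge_graded_commute:
  assumes "\<And>vs. length vs \<noteq> k \<Longrightarrow> \<alpha> vs = 0"
  shows "lwedge \<alpha> \<beta> vs = lwedge ((parity_twist ^^ k) \<beta>) \<alpha> vs"
  using assms
proof (induction vs arbitrary: k \<alpha> \<beta>)
  case Nil
  have "(parity_twist ^^ k) \<beta> [] = \<beta> []"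
    by (induction k) (simp_all add: parity_twist_def)
  then show ?case by simp
next
  case (Cons v vs)
  have twist: "parity_twist \<alpha> = (\<lambda>us. (-1) ^ k * \<alpha> us)"
    using Cons.prems by (auto simp: parity_twist_def fun_eq_iff) metis
  have contr: "contract v ((parity_twist ^^ k) \<beta>) =
      (\<lambda>us. (-1) ^ k * (parity_twist ^^ k) (contract v \<beta>) us)" for k
  proof (induction k)
    case (Suc k)
    then show ?case
      by (simp only: funpow.simps o_apply contract_parity_twist)
        (simp add: parity_twist_def fun_eq_iff)
  qed simp
  \<comment> \<open>The induction hypothesis gives \<open>k - 1\<close> twists. The twist is an
    involution, so \<open>Suc k\<close> twists are the same, and this form also makes sense for
    \<open>k = 0\<close>, where the contraction vanishes.\<close>
  have IH1: "lwedge (contract v \<alpha>) \<beta> vs = lwedge ((parity_twist ^^ (Suc k)) \<beta>) (contract v \<alpha>) vs"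
  proof (cases k)
    case 0
    then have "contract v \<alpha> = (\<lambda>_. 0)"
      using Cons.prems by (simp add: contract_def fun_eq_iff)
    then show ?thesis by simp
  next
    case (Suc k')
    then have "lwedge (contract v \<alpha>) \<beta> vs = lwedge ((parity_twist ^^ k') \<beta>) (contract v \<alpha>) vs"
      using Cons.prems by (intro Cons.IH) (simp add: contract_def)
    then show ?thesis using Suc by simp
  qed
  have IH2: "lwedge \<alpha> (contract v \<beta>) vs = lwedge ((parity_twist ^^ k) (contract v \<beta>)) \<alpha> vs"
    using Cons.prems by (intro Cons.IH)
  show ?case
    by (simp add: lwedge_Cons IH1 twist contr lwedge_scale_left IH2)
qed

section \<open>Smooth functions and bump functions\<close>

lemma Ck_on_cong:
  assumes "open S" "\<And>x. x \<in> S \<Longrightarrow> f x = g x" "Ck_on k S f"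
  shows "Ck_on k S g"
  using assms
proof (induction k arbitrary: f g)
  case 0
  then show ?case using continuous_on_cong[of S S f g] by simp
next
  case (Suc k)
  have deriv: "(g has_derivative frechet_derivative f (at x)) (at x)" if "x \<in> S" for x
    using that Suc.prems
    by (intro has_derivative_transform_within_open[of f _ x UNIV S g])
      (auto simp: frechet_derivative_works)
  then have eq: "frechet_derivative f (at x) = frechet_derivative g (at x)" if "x \<in> S" for x
    using frechet_derivative_at[OF deriv[OF that]] by simp
  have "Ck_on k S (\<lambda>x. frechet_derivative g (at x) v)" for v
    by (rule Suc.IH[of "\<lambda>x. frechet_derivative f (at x) v"]) (use Suc.prems eq in auto)
  then show ?case using deriv by (auto simp: differentiable_def)
qed

text \<open>Admits a derivative computed by hand in place of
  \<open>frechet_derivative\<close>.\<close>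

lemma Ck_on_SucI:
  assumes "open S" "\<And>x. x \<in> S \<Longrightarrow> (f has_derivative f' x) (at x)"
    and "\<And>v. Ck_on k S (\<lambda>x. f' x v)"
  shows "Ck_on (Suc k) S f"
proof -
  have "f' x = frechet_derivative f (at x)" if "x \<in> S" for x
    using frechet_derivative_at[OF assms(2)[OF that]] by simp
  note eq = this
  have "Ck_on k S (\<lambda>x. frechet_derivative f (at x) v)" for v
    by (rule Ck_on_cong[of S "\<lambda>x. f' x v"]) (use assms eq in auto)
  then show ?thesis using assms(2) by (auto simp: differentiable_def)
qed

lemma Ck_on_has_derivative:
  "Ck_on (Suc k) S f \<Longrightarrow> x \<in> S \<Longrightarrow> (f has_derivative frechet_derivative f (at x)) (at x)"
  by (simp add: frechet_derivative_works)

lemma Ck_on_SucD: "Ck_on (Suc k) S f \<Longrightarrow> Ck_on k S f"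
proof (induction k arbitrary: f)
  case 0
  then show ?case
    by (auto intro!: continuous_at_imp_continuous_on differentiable_imp_continuous_within)
qed auto

lemma Ck_on_subset: "Ck_on k S f \<Longrightarrow> T \<subseteq> S \<Longrightarrow> Ck_on k T f"
  by (induction k arbitrary: f) (auto intro: continuous_on_subset)

lemma Ck_on_Un: "open S \<Longrightarrow> open T \<Longrightarrow> Ck_on k S f \<Longrightarrow> Ck_on k T f \<Longrightarrow> Ck_on k (S \<union> T) f"
  by (induction k arbitrary: f) (auto intro: continuous_on_open_Un)

lemma Ck_on_const: "Ck_on k S (\<lambda>x. c)"
  by (induction k arbitrary: c) auto

lemma Ck_on_add:
  assumes "open S" "Ck_on k S f" "Ck_on k S g"
  shows "Ck_on k S (\<lambda>x. f x + g x)"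
  using assms
proof (induction k arbitrary: f g)
  case 0
  then show ?case by (auto intro: continuous_intros)
next
  case (Suc k)
  show ?case
    by (rule Ck_on_SucI[where f' = "\<lambda>x v. frechet_derivative f (at x) v + frechet_derivative g (at x) v"])
      (use Suc.prems in \<open>auto intro!: has_derivative_add Suc.IH simp: frechet_derivative_works\<close>)
qed

text \<open>Stated for bilinear maps to cover both the product of reals and the inner product in the
  bump function.\<close>

lemma (in bounded_bilinear) Ck_on_prod:
  assumes "open S" "Ck_on k S f" "Ck_on k S g"
  shows "Ck_on k S (\<lambda>x. prod (f x) (g x))"
  using assms
proof (induction k arbitrary: f g)
  case 0
  then show ?case by (auto intro: continuous_on)
next
  case (Suc k)
  have "Ck_on k S f" "Ck_on k S g"
    using Suc.prems by (auto intro: Ck_on_SucD)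
  then show ?case
    by (intro Ck_on_SucI[where f' = "\<lambda>x v. prod (f x) (frechet_derivative g (at x) v) +
            prod (frechet_derivative f (at x) v) (g x)"])
      (use Suc.prems in \<open>auto intro!: FDERIV Ck_on_add Suc.IH simp: frechet_derivative_works\<close>)
qed

text \<open>This family is closed under differentiation up to linear combinations.\<close>

definition flat_exp :: "nat \<Rightarrow> real \<Rightarrow> real" where
  "flat_exp n t = (if t > 0 then exp (- 1 / t) / t ^ n else 0)"

text \<open>Substituting s = 1/t turns the limit from the right into that of s^n / exp s at
  infinity.\<close>

lemma flat_exp_tendsto_0: "(flat_exp n \<longlongrightarrow> 0) (at 0)"
proof (rule filterlim_split_at)
  show "(flat_exp n \<longlongrightarrow> 0) (at_left 0)"
    by (rule Lim_transform_eventually[of "\<lambda>_. 0"])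
      (auto simp: flat_exp_def eventually_at_filter)
  have "((\<lambda>t. (inverse t) ^ n / exp (inverse t)) \<longlongrightarrow> 0) (at_right (0::real))"
    by (rule filterlim_compose[OF tendsto_power_div_exp_0 filterlim_inverse_at_top_right])
  then show "(flat_exp n \<longlongrightarrow> 0) (at_right 0)"
    by (rule Lim_transform_eventually)
      (auto simp: flat_exp_def eventually_at_filter exp_minus field_simps power_inverse)
qed

lemma flat_exp_has_derivative:
  "(flat_exp n has_real_derivative flat_exp (n + 2) t - n * flat_exp (n + 1) t) (at t)"
proof (cases t "0::real" rule: linorder_cases)
  case less
  have "((\<lambda>_. 0) has_real_derivative 0) (at t)" by simp
  then have "(flat_exp n has_real_derivative 0) (at t)"
    by (rule has_field_derivative_transform_within_open[of _ _ _ "{..<0}"])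
      (use less in \<open>auto simp: flat_exp_def\<close>)
  then show ?thesis using less by (simp add: flat_exp_def)
next
  case equal
  \<comment> \<open>At 0 the difference quotient is the next member of the family, which tends to
    0.\<close>
  have "(\<lambda>h. (flat_exp n h - flat_exp n 0) / (h - 0)) = flat_exp (Suc n)"
    by (auto simp: flat_exp_def fun_eq_iff)
  then show ?thesis
    using flat_exp_tendsto_0[of "Suc n"] equal
    by (simp add: has_field_derivative_iff flat_exp_def[of _ 0])
next
  case greater
  have "((\<lambda>t. exp (- 1 / t) / t ^ n) has_real_derivative
      flat_exp (n + 2) t - n * flat_exp (n + 1) t) (at t)"
    using greater
    apply (auto intro!: derivative_eq_intros)
    by (cases n) (simp_all add: flat_exp_def field_simps power2_eq_square)
  then show ?thesis
    by (rule has_field_derivative_transform_within_open[of _ _ _ "{0<..}"])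
      (use greater in \<open>auto simp: flat_exp_def\<close>)
qed

text \<open>The index \<open>n\<close> varies in the induction, since differentiation raises it by
  one and by two.\<close>

lemma Ck_on_flat_exp:
  assumes "open S" "Ck_on k S u"
  shows "Ck_on k S (\<lambda>x. flat_exp n (u x))"
  using assms
proof (induction k arbitrary: n)
  case 0
  have "continuous_on UNIV (flat_exp n)"
    by (rule DERIV_continuous_on, rule flat_exp_has_derivative)
  then show ?case using 0 by (auto intro: continuous_on_compose2)
next
  case (Suc k)
  have u: "Ck_on k S u" using Suc.prems Ck_on_SucD by blast
  have c: "Ck_on k S (\<lambda>x. flat_exp (n + 2) (u x) + (- real n) * flat_exp (n + 1) (u x))"
    by (intro Ck_on_add bounded_bilinear.Ck_on_prod[OF bounded_bilinear_mult] Ck_on_const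
        Suc.IH Suc.prems(1) u)
  show ?case
  proof (rule Ck_on_SucI[where f' = "\<lambda>x v.
        (flat_exp (n + 2) (u x) + (- real n) * flat_exp (n + 1) (u x)) * frechet_derivative u (at x) v"])
    show "((\<lambda>x. flat_exp n (u x)) has_derivative
        (\<lambda>v. (flat_exp (n + 2) (u x) + - real n * flat_exp (n + 1) (u x)) *
               frechet_derivative u (at x) v)) (at x)" if "x \<in> S" for x
      using has_derivative_compose[OF Ck_on_has_derivative[OF Suc.prems(2) that]
          flat_exp_has_derivative[of n "u x", unfolded has_field_derivative_def]]
      by simp
    show "Ck_on k S (\<lambda>x. (flat_exp (n + 2) (u x) + (- real n) * flat_exp (n + 1) (u x)) *
        frechet_derivative u (at x) v)" for v
      using c Suc.prems
      by (intro bounded_bilinear.Ck_on_prod[OF bounded_bilinear_mult]) auto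
  qed (rule Suc.prems)
qed

section \<open>Smooth functions on the base, and bump functions\<close>

context
  fixes A :: "('m, 'e::{real_inner,heine_borel}, 'a, 'z) vbundle_scheme"
  assumes manifold: "smooth_manifold A"
begin

lemma chart_openin: "(V, \<phi>) \<in> charts A \<Longrightarrow> openin (base A) V"
  using manifold unfolding smooth_manifold_def by blast

lemma chart_homeomorphic:
  "(V, \<phi>) \<in> charts A \<Longrightarrow> homeomorphic_map (subtopology (base A) V) (top_of_set (\<phi> ` V)) \<phi>"
  using manifold unfolding smooth_manifold_def by blast

lemma chart_inj_on: "(V, \<phi>) \<in> charts A \<Longrightarrow> inj_on \<phi> V"
  using homeomorphic_imp_injective_map[OF chart_homeomorphic] openin_subset[OF chart_openin]
  by (metis topspace_subtopology_subset)

lemma chart_image_open: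
  assumes c: "(V, \<phi>) \<in> charts A" and U: "openin (base A) U"
  shows "open (\<phi> ` (U \<inter> V))"
proof -
  have "openin (subtopology (base A) V) (U \<inter> V)"
    using U by (auto simp: openin_subtopology)
  then have "openin (top_of_set (\<phi> ` V)) (\<phi> ` (U \<inter> V))"
    using homeomorphic_imp_open_map[OF chart_homeomorphic[OF c]] by (simp add: open_map_def)
  moreover have "open (\<phi> ` V)"
    using manifold c unfolding smooth_manifold_def by blast
  ultimately show ?thesis by (simp add: openin_open_eq)
qed

lemma smooth_fun_chart:
  "smooth_fun A U f \<Longrightarrow> (V, \<phi>) \<in> charts A \<Longrightarrow> Ck_on k (\<phi> ` (U \<inter> V)) (f \<circ> inv_into V \<phi>)"
  by (auto simp: smooth_fun_def smooth_on_def)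

lemma smooth_fun_add:
  assumes "openin (base A) U" "smooth_fun A U f" "smooth_fun A U g"
  shows "smooth_fun A U (\<lambda>p. f p + g p)"
  unfolding smooth_fun_def smooth_on_def o_def
proof clarify
  fix V \<phi> k assume c: "(V, \<phi>) \<in> charts A"
  show "Ck_on k (\<phi> ` (U \<inter> V)) (\<lambda>x. f (inv_into V \<phi> x) + g (inv_into V \<phi> x))"
    using smooth_fun_chart[OF assms(2) c, of k] smooth_fun_chart[OF assms(3) c, of k]
    by (intro Ck_on_add chart_image_open[OF c assms(1)]) (simp_all add: o_def)
qed

lemma smooth_fun_mult:
  assumes "openin (base A) U" "smooth_fun A U f" "smooth_fun A U g"
  shows "smooth_fun A U (\<lambda>p. f p * g p)"
  unfolding smooth_fun_def smooth_on_def o_def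
proof clarify
  fix V \<phi> k assume c: "(V, \<phi>) \<in> charts A"
  show "Ck_on k (\<phi> ` (U \<inter> V)) (\<lambda>x. f (inv_into V \<phi> x) * g (inv_into V \<phi> x))"
    using smooth_fun_chart[OF assms(2) c, of k] smooth_fun_chart[OF assms(3) c, of k]
    by (intro bounded_bilinear.Ck_on_prod[OF bounded_bilinear_mult] chart_image_open[OF c assms(1)])
      (simp_all add: o_def)
qed

lemma smooth_fun_const: "smooth_fun A U (\<lambda>_. c)"
  by (auto simp: smooth_fun_def smooth_on_def o_def intro: Ck_on_const)

lemma smooth_fun_sum:
  assumes "openin (base A) U" "\<And>i. i \<in> I \<Longrightarrow> smooth_fun A U (f i)"
  shows "smooth_fun A U (\<lambda>p. \<Sum>i\<in>I. f i p)"
  using assms(2)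
  by (induction I rule: infinite_finite_induct)
    (auto intro: smooth_fun_const smooth_fun_add assms(1))

lemma smooth_fun_subset: "smooth_fun A U f \<Longrightarrow> U' \<subseteq> U \<Longrightarrow> smooth_fun A U' f"
  unfolding smooth_fun_def smooth_on_def
  by (blast intro: Ck_on_subset[OF _ image_mono[OF Int_mono]])

lemma smooth_fun_cong:
  assumes "openin (base A) U" "\<And>p. p \<in> U \<Longrightarrow> f p = g p" "smooth_fun A U f"
  shows "smooth_fun A U g"
  unfolding smooth_fun_def smooth_on_def
proof clarify
  fix V \<phi> k assume c: "(V, \<phi>) \<in> charts A"
  have "Ck_on k (\<phi> ` (U \<inter> V)) (f \<circ> inv_into V \<phi>)"
    using assms(3) c by (auto simp: smooth_fun_def smooth_on_def)
  then show "Ck_on k (\<phi> ` (U \<inter> V)) (g \<circ> inv_into V \<phi>)"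
    by (rule Ck_on_cong[rotated 2])
      (use chart_image_open[OF c assms(1)] chart_inj_on[OF c] assms(2) in auto)
qed

text \<open>Smoothness is local on open sets; this glues a function to its extension by
  zero.\<close>

lemma smooth_fun_Un:
  assumes "openin (base A) U" "openin (base A) U'" "smooth_fun A U f" "smooth_fun A U' f"
  shows "smooth_fun A (U \<union> U') f"
  unfolding smooth_fun_def smooth_on_def
proof clarify
  fix V \<phi> k assume c: "(V, \<phi>) \<in> charts A"
  show "Ck_on k (\<phi> ` ((U \<union> U') \<inter> V)) (f \<circ> inv_into V \<phi>)"
    unfolding Int_Un_distrib2 image_Un
    by (intro Ck_on_Un chart_image_open[OF c] smooth_fun_chart[OF _ c] assms)
qed

text \<open>In a chart around \<open>p\<close>, take \<open>flat_exp 0\<close> of \<epsilon>^2 minus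
  the squared distance to the image of \<open>p\<close>. \<open>K\<close> is the preimage of the
  closed ball: compact by the Heine-Borel property of the model space, hence closed in the Hausdorff
  base and not merely in the chart domain, so the extension by zero is smooth.\<close>

lemma bump_function:
  assumes U: "openin (base A) U" and p: "p \<in> U"
  obtains f K where "smooth_fun A (topspace (base A)) f" "f p \<noteq> 0"
    "closedin (base A) K" "K \<subseteq> U" "\<And>q. q \<notin> K \<Longrightarrow> f q = 0"
proof -
  have "p \<in> topspace (base A)" using openin_subset[OF U] p by auto
  then obtain V \<phi> where c: "(V, \<phi>) \<in> charts A" and pV: "p \<in> V"
    using manifold unfolding smooth_manifold_def by blast
  obtain \<epsilon> where \<epsilon>: "\<epsilon> > 0" "cball (\<phi> p) \<epsilon> \<subseteq> \<phi> ` (U \<inter> V)"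
    using chart_image_open[OF c U] p pV open_contains_cball by blast
  obtain g where g: "homeomorphic_maps (subtopology (base A) V) (top_of_set (\<phi> ` V)) \<phi> g"
    using chart_homeomorphic[OF c] homeomorphic_map_maps by blast
  have V_top: "V \<subseteq> topspace (base A)" using openin_subset[OF chart_openin[OF c]] .
  have g_inv: "g (\<phi> q) = q" if "q \<in> V" for q
    using g that V_top by (auto simp: homeomorphic_maps_def)
  define K where "K = g ` cball (\<phi> p) \<epsilon>"
  define f where "f q = (if q \<in> V then flat_exp 0 (\<epsilon>^2 - (\<phi> q - \<phi> p) \<bullet> (\<phi> q - \<phi> p)) else 0)" for q
  have "compactin (top_of_set (\<phi> ` V)) (cball (\<phi> p) \<epsilon>)"
    using \<epsilon> by (auto simp: compactin_subtopology)
  moreover have "continuous_map (top_of_set (\<phi> ` V)) (base A) g"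
    using g by (auto simp: homeomorphic_maps_def continuous_map_in_subtopology)
  ultimately have "compactin (base A) K"
    unfolding K_def by (rule image_compactin)
  then have K_closed: "closedin (base A) K"
    using manifold by (intro compactin_imp_closedin) (auto simp: smooth_manifold_def)
  have K_sub: "K \<subseteq> U"
    using \<epsilon>(2) g_inv unfolding K_def by force
  have f_out: "f q = 0" if "q \<notin> K" for q
  proof (rule ccontr)
    assume "f q \<noteq> 0"
    then have q: "q \<in> V" "(\<phi> q - \<phi> p) \<bullet> (\<phi> q - \<phi> p) < \<epsilon>^2"
      by (auto simp: f_def flat_exp_def split: if_splits)
    then have "norm (\<phi> q - \<phi> p) < \<epsilon>"
      using \<epsilon>(1) by (simp add: power2_norm_eq_inner[symmetric] power2_less_imp_less)
    then have "\<phi> q \<in> cball (\<phi> p) \<epsilon>" by (simp add: dist_norm norm_minus_commute)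
    then have "q \<in> K" unfolding K_def using g_inv[OF q(1)] by force
    then show False using that by simp
  qed
  have compl: "openin (base A) (topspace (base A) - K)"
    using K_closed by (simp add: closedin_def)
  have "smooth_fun A V f"
    unfolding smooth_fun_def smooth_on_def
  proof clarify
    fix W \<psi> k assume d: "(W, \<psi>) \<in> charts A"
    let ?T = "\<phi> \<circ> inv_into W \<psi>"
    have op: "open (\<psi> ` (V \<inter> W))" by (rule chart_image_open[OF d chart_openin[OF c]])
    \<comment> \<open>Read in another chart, the coordinate \<phi> is a transition map.\<close>
    have "Ck_on k (\<psi> ` (V \<inter> W)) ?T"
      using manifold c d unfolding smooth_manifold_def smooth_on_def Int_commute[of V] by blast
    then have T: "Ck_on k (\<psi> ` (V \<inter> W)) (\<lambda>y. ?T y + - \<phi> p)"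
      by (intro Ck_on_add op Ck_on_const)
    have "Ck_on k (\<psi> ` (V \<inter> W))
        (\<lambda>y. flat_exp 0 (\<epsilon>^2 + - 1 * ((?T y + - \<phi> p) \<bullet> (?T y + - \<phi> p))))"
      by (intro Ck_on_flat_exp Ck_on_add op Ck_on_const T
          bounded_bilinear.Ck_on_prod[OF bounded_bilinear_mult]
          bounded_bilinear.Ck_on_prod[OF bounded_bilinear_inner])
    then show "Ck_on k (\<psi> ` (V \<inter> W)) (f \<circ> inv_into W \<psi>)"
      by (rule Ck_on_cong[OF op, rotated]) (use chart_inj_on[OF d] in \<open>auto simp: f_def\<close>)
  qed
  moreover have "smooth_fun A (topspace (base A) - K) f"
    using f_out by (intro smooth_fun_cong[OF compl _ smooth_fun_const[of _ 0]]) auto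
  ultimately have "smooth_fun A (V \<union> (topspace (base A) - K)) f"
    by (intro smooth_fun_Un chart_openin[OF c] compl)
  \<comment> \<open>\<open>K\<close> lies in \<open>V\<close>, so \<open>V\<close> and the
    complement of \<open>K\<close> form an open cover.\<close>
  moreover have "topspace (base A) \<subseteq> V \<union> (topspace (base A) - K)"
    using \<epsilon>(2) g_inv unfolding K_def by force
  ultimately have "smooth_fun A (topspace (base A)) f"
    by (rule smooth_fun_subset)
  moreover have "f p \<noteq> 0" using pV \<epsilon>(1) by (simp add: f_def flat_exp_def)
  ultimately show thesis using that[of f K] K_closed K_sub f_out by blast
qed

end

section \<open>Alternating forms\<close>

lemma alternating_formsD:
  assumes "\<alpha> \<in> alternating_forms V"
  shows "\<not> set vs \<subseteq> V \<Longrightarrow> \<alpha> vs = 0"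
    and "set vs \<subseteq> V \<Longrightarrow> i < length vs \<Longrightarrow> u \<in> V \<Longrightarrow> v \<in> V \<Longrightarrow>
      \<alpha> (vs[i := u + v]) = \<alpha> (vs[i := u]) + \<alpha> (vs[i := v])"
    and "set vs \<subseteq> V \<Longrightarrow> i < length vs \<Longrightarrow> u \<in> V \<Longrightarrow> \<alpha> (vs[i := c *\<^sub>R u]) = c * \<alpha> (vs[i := u])"
    and "set vs \<subseteq> V \<Longrightarrow> i < j \<Longrightarrow> j < length vs \<Longrightarrow> vs ! i = vs ! j \<Longrightarrow> \<alpha> vs = 0"
  using assms unfolding alternating_forms_def by blast+

lemma alternating_forms_outside: "\<alpha> \<in> alternating_forms V \<Longrightarrow> \<not> set vs \<subseteq> V \<Longrightarrow> \<alpha> vs = 0"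
  by (rule alternating_formsD(1))

lemma alternating_forms_add_Cons:
  assumes "\<alpha> \<in> alternating_forms V" "u \<in> V" "v \<in> V"
  shows "set vs \<subseteq> V \<Longrightarrow> \<alpha> ((u + v) # vs) = \<alpha> (u # vs) + \<alpha> (v # vs)"
  using alternating_formsD(2)[OF assms(1), of "u # vs" 0 u v] assms(2,3) by simp

lemma alternating_forms_scale_Cons:
  assumes "\<alpha> \<in> alternating_forms V" "u \<in> V"
  shows "set vs \<subseteq> V \<Longrightarrow> \<alpha> ((c *\<^sub>R u) # vs) = c * \<alpha> (u # vs)"
  using alternating_formsD(3)[OF assms(1), of "u # vs" 0 u c] assms(2) by simp

text \<open>By polarization, vanishing on repeated neighbours gives antisymmetry under adjacent
  transpositions, which move equal arguments next to each other.\<close>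

lemma alternating_formsI:
  fixes \<alpha> :: "'a::real_vector list \<Rightarrow> real"
  assumes V: "subspace V"
    and outside: "\<And>vs. \<not> set vs \<subseteq> V \<Longrightarrow> \<alpha> vs = 0"
    and add: "\<And>xs u v ys. set (xs @ ys) \<subseteq> V \<Longrightarrow> u \<in> V \<Longrightarrow> v \<in> V \<Longrightarrow>
      \<alpha> (xs @ (u + v) # ys) = \<alpha> (xs @ u # ys) + \<alpha> (xs @ v # ys)"
    and scale: "\<And>xs u c ys. set (xs @ ys) \<subseteq> V \<Longrightarrow> u \<in> V \<Longrightarrow>
      \<alpha> (xs @ (c *\<^sub>R u) # ys) = c * \<alpha> (xs @ u # ys)"
    and adj: "\<And>xs v ys. set (xs @ ys) \<subseteq> V \<Longrightarrow> v \<in> V \<Longrightarrow> \<alpha> (xs @ v # v # ys) = 0"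
  shows "\<alpha> \<in> alternating_forms V"
proof -
  have swap: "\<alpha> (xs @ u # v # ys) = - \<alpha> (xs @ v # u # ys)"
    if "set (xs @ ys) \<subseteq> V" "u \<in> V" "v \<in> V" for xs u v ys
  proof -
    have uv: "u + v \<in> V" using V that by (simp add: subspace_add)
    have "0 = \<alpha> (xs @ (u + v) # (u + v) # ys)" using adj that uv by simp
    also have "\<dots> = \<alpha> (xs @ u # (u + v) # ys) + \<alpha> (xs @ v # (u + v) # ys)"
      using add[of xs "(u + v) # ys" u v] that uv by simp
    also have "\<dots> = \<alpha> (xs @ u # v # ys) + \<alpha> (xs @ v # u # ys)"
      using add[of "xs @ [u]" ys u v] add[of "xs @ [v]" ys u v] adj[of xs ys u] adj[of xs ys v] that
      by simp
    finally show ?thesis by simp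
  qed
  have repeat: "\<alpha> (xs @ v # ys @ v # zs) = 0" if "set (xs @ ys @ zs) \<subseteq> V" "v \<in> V" for xs v ys zs
    using that
  proof (induction ys arbitrary: xs)
    case Nil
    then show ?case using adj by simp
  next
    case (Cons y ys)
    then show ?case
      using Cons.IH[of "xs @ [y]"] swap[of xs "ys @ v # zs" v y] by simp
  qed
  have split: "vs = take i vs @ vs ! i # drop (Suc i) vs" if "i < length vs" for i and vs :: "'a list"
    using that by (simp add: id_take_nth_drop)
  have sub: "set (take i vs @ drop (Suc i) vs) \<subseteq> V" if "set vs \<subseteq> V" for i vs
    using that set_take_subset set_drop_subset by fastforce
  have "\<alpha> vs = 0" if vs: "set vs \<subseteq> V" "i < j" "j < length vs" "vs ! i = vs ! j" for vs i j
  proof -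
    let ?ws = "drop (Suc i) vs" and ?k = "j - Suc i"
    have "?ws = take ?k ?ws @ ?ws ! ?k # drop (Suc ?k) ?ws"
      using vs by (intro split) auto
    moreover have "?ws ! ?k = vs ! i" using vs by simp
    ultimately have eq: "vs = take i vs @ vs ! i # take ?k ?ws @ vs ! i # drop (Suc ?k) ?ws"
      using split[of i vs] vs by simp
    have "set (take i vs @ take ?k ?ws @ drop (Suc ?k) ?ws) \<subseteq> V"
      using vs(1) by (auto dest: in_set_takeD in_set_dropD)
    then show ?thesis using repeat[of "take i vs" "take ?k ?ws" "drop (Suc ?k) ?ws" "vs ! i"] eq vs
      by (metis in_mono less_trans nth_mem)
  qed
  moreover have "\<alpha> (vs[i := u + v]) = \<alpha> (vs[i := u]) + \<alpha> (vs[i := v])"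
    if "set vs \<subseteq> V" "i < length vs" "u \<in> V" "v \<in> V" for vs i u v
    using add[OF sub[OF that(1)] that(3,4)] that(2) by (simp add: upd_conv_take_nth_drop)
  moreover have "\<alpha> (vs[i := c *\<^sub>R u]) = c * \<alpha> (vs[i := u])"
    if "set vs \<subseteq> V" "i < length vs" "u \<in> V" for vs i u c
    using scale[OF sub[OF that(1)] that(3)] that(2) by (simp add: upd_conv_take_nth_drop)
  ultimately show ?thesis using outside unfolding alternating_forms_def mem_Collect_eq by blast
qed

lemma zero_alternating: "(\<lambda>_. 0) \<in> alternating_forms V"
  by (simp add: alternating_forms_def)

lemma alternating_forms_plus:
  "\<alpha> \<in> alternating_forms V \<Longrightarrow> \<beta> \<in> alternating_forms V \<Longrightarrow> (\<lambda>vs. \<alpha> vs + \<beta> vs) \<in> alternating_forms V"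
  unfolding alternating_forms_def mem_Collect_eq by (auto simp: algebra_simps)

lemma alternating_forms_times:
  "\<alpha> \<in> alternating_forms V \<Longrightarrow> (\<lambda>vs. c * \<alpha> vs) \<in> alternating_forms V"
  unfolding alternating_forms_def mem_Collect_eq by (auto simp: algebra_simps)

text \<open>The defining conditions only compare lists of equal length, so the factor may depend on
  the degree. Both the parity twist and the projection to one degree have this shape.\<close>

lemma alternating_forms_length_times:
  "\<alpha> \<in> alternating_forms V \<Longrightarrow> (\<lambda>vs. c (length vs) * \<alpha> vs) \<in> alternating_forms V"
  unfolding alternating_forms_def mem_Collect_eq by (auto simp: algebra_simps)

lemma parity_twist_alternating: "\<alpha> \<in> alternating_forms V \<Longrightarrow> parity_twist \<alpha> \<in> alternating_forms V"
  using alternating_forms_length_times[of \<alpha> V "\<lambda>n. (-1) ^ n"] by (simp add: parity_twist_def[abs_def])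

lemma contract_alternating:
  assumes "\<alpha> \<in> alternating_forms V" "v \<in> V"
  shows "contract v \<alpha> \<in> alternating_forms V"
proof -
  note a = alternating_formsD[OF assms(1)]
  have "contract v \<alpha> (vs[i := u + w]) = contract v \<alpha> (vs[i := u]) + contract v \<alpha> (vs[i := w])"
    if "set vs \<subseteq> V" "i < length vs" "u \<in> V" "w \<in> V" for vs i u w
    using a(2)[of "v # vs" "Suc i" u w] that assms(2) by (simp add: contract_def)
  moreover have "contract v \<alpha> (vs[i := c *\<^sub>R u]) = c * contract v \<alpha> (vs[i := u])"
    if "set vs \<subseteq> V" "i < length vs" "u \<in> V" for vs i u c
    using a(3)[of "v # vs" "Suc i" u c] that assms(2) by (simp add: contract_def)
  moreover have "contract v \<alpha> vs = 0"
    if "set vs \<subseteq> V" "i < j" "j < length vs" "vs ! i = vs ! j" for vs i j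
    using a(4)[of "v # vs" "Suc i" "Suc j"] that assms(2) by (simp add: contract_def)
  moreover have "contract v \<alpha> vs = 0" if "\<not> set vs \<subseteq> V" for vs
    using a(1) that by (simp add: contract_def)
  ultimately show ?thesis unfolding alternating_forms_def mem_Collect_eq by blast
qed

lemma contract_outside: "\<alpha> \<in> alternating_forms V \<Longrightarrow> v \<notin> V \<Longrightarrow> contract v \<alpha> = (\<lambda>_. 0)"
  by (auto simp: contract_def fun_eq_iff alternating_forms_outside)

lemma contract_plus: "contract v (\<alpha> + \<beta>) = contract v \<alpha> + contract v \<beta>"
  by (simp add: contract_def fun_eq_iff)

lemma contract_add:
  assumes "\<alpha> \<in> alternating_forms V" "u \<in> V" "v \<in> V"
  shows "contract (u + v) \<alpha> = contract u \<alpha> + contract v \<alpha>"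
proof
  fix vs show "contract (u + v) \<alpha> vs = (contract u \<alpha> + contract v \<alpha>) vs"
    using assms by (cases "set vs \<subseteq> V")
      (auto simp: contract_def alternating_forms_add_Cons alternating_forms_outside)
qed

lemma contract_scale:
  assumes "\<alpha> \<in> alternating_forms V" "u \<in> V"
  shows "contract (c *\<^sub>R u) \<alpha> = (\<lambda>vs. c * contract u \<alpha> vs)"
proof
  fix vs show "contract (c *\<^sub>R u) \<alpha> vs = c * contract u \<alpha> vs"
    using assms by (cases "set vs \<subseteq> V")
      (auto simp: contract_def alternating_forms_scale_Cons alternating_forms_outside)
qed

lemma contract_twice:
  assumes "\<alpha> \<in> alternating_forms V"
  shows "contract v (contract v \<alpha>) = (\<lambda>_. 0)"
proof
  fix vs show "contract v (contract v \<alpha>) vs = 0"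
    using assms alternating_formsD(4)[OF assms, of "v # v # vs" 0 1]
    by (cases "set (v # vs) \<subseteq> V") (auto simp: contract_def alternating_forms_outside)
qed

text \<open>Polarization: the double contraction by \<open>u + v\<close> vanishes; expand
  it.\<close>

lemma contract_swap:
  assumes "subspace V" "\<alpha> \<in> alternating_forms V" "u \<in> V" "v \<in> V"
  shows "contract u (contract v \<alpha>) = (\<lambda>vs. - 1 * contract v (contract u \<alpha>) vs)"
proof
  fix vs
  have uv: "u + v \<in> V" using assms by (simp add: subspace_add)
  have "contract (u + v) (contract (u + v) \<alpha>) =
      contract u (contract u \<alpha>) + contract u (contract v \<alpha>) +
      (contract v (contract u \<alpha>) + contract v (contract v \<alpha>))"
    unfolding contract_add[OF contract_alternating[OF assms(2) uv] assms(3,4)]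
    unfolding contract_add[OF assms(2-4)] contract_plus ..
  then have "contract u (contract v \<alpha>) vs + contract v (contract u \<alpha>) vs = 0"
    by (simp add: contract_twice[OF assms(2)] fun_eq_iff)
  then show "contract u (contract v \<alpha>) vs = - 1 * contract v (contract u \<alpha>) vs"
    by (simp add: contract_twice[OF assms(2)])
qed

text \<open>The recursion strips leading arguments until the position in question comes first.
  There, linearity of contraction or the vanishing of a double contraction decides.\<close>

lemma lwedge_alternating:
  assumes V: "subspace V" and "\<alpha> \<in> alternating_forms V" "\<beta> \<in> alternating_forms V"
  shows "lwedge \<alpha> \<beta> \<in> alternating_forms V"
proof (rule alternating_formsI[OF V])
  show "lwedge \<alpha> \<beta> vs = 0" if "\<not> set vs \<subseteq> V" for vs
    using assms(2,3) that
  proof (induction vs arbitrary: \<alpha> \<beta>)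
    case (Cons v vs)
    then show ?case
      by (cases "v \<in> V")
        (auto simp: lwedge_Cons contract_outside contract_alternating parity_twist_alternating)
  qed simp
next
  fix xs ys u v assume "set (xs @ ys) \<subseteq> V" "u \<in> V" "v \<in> V"
  then show "lwedge \<alpha> \<beta> (xs @ (u + v) # ys) = lwedge \<alpha> \<beta> (xs @ u # ys) + lwedge \<alpha> \<beta> (xs @ v # ys)"
    using assms(2,3)
    by (induction xs arbitrary: \<alpha> \<beta>)
      (auto simp: lwedge_Cons contract_alternating parity_twist_alternating contract_add[of _ V]
        lwedge_add_left lwedge_add_right)
next
  fix xs ys u c assume "set (xs @ ys) \<subseteq> V" "u \<in> V"
  then show "lwedge \<alpha> \<beta> (xs @ (c *\<^sub>R u) # ys) = c * lwedge \<alpha> \<beta> (xs @ u # ys)"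
    using assms(2,3)
    by (induction xs arbitrary: \<alpha> \<beta>)
      (auto simp: lwedge_Cons contract_alternating parity_twist_alternating contract_scale[of _ V]
        lwedge_scale_left lwedge_scale_right algebra_simps)
next
  fix xs ys v assume "set (xs @ ys) \<subseteq> V" "v \<in> V"
  then show "lwedge \<alpha> \<beta> (xs @ v # v # ys) = 0"
    using assms(2,3)
  proof (induction xs arbitrary: \<alpha> \<beta>)
    case Nil
    \<comment> \<open>Contracting twice leaves two mixed terms, which cancel because the twist
      anticommutes with contraction.\<close>
    then show ?case
      by (simp add: lwedge_Cons contract_twice[of _ V] contract_parity_twist
          lwedge_scale_left[of "-1", simplified])
  next
    case (Cons x xs)
    then show ?case
      by (simp add: lwedge_Cons contract_alternating parity_twist_alternating)
  qed
qed

lemma alternating_sum_Cons: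
  assumes "subspace V" "\<alpha> \<in> alternating_forms V" "\<And>j. j \<in> J \<Longrightarrow> v j \<in> V"
  shows "\<alpha> ((\<Sum>j\<in>J. c j *\<^sub>R v j) # vs) = (\<Sum>j\<in>J. c j * \<alpha> (v j # vs))"
proof -
  have zero: "contract 0 \<alpha> = (\<lambda>_. 0)"
    using contract_scale[OF assms(2) subspace_0[OF assms(1)], of 0] by simp
  have "contract (\<Sum>j\<in>J. c j *\<^sub>R v j) \<alpha> vs = (\<Sum>j\<in>J. c j * contract (v j) \<alpha> vs)"
    using assms(3)
    by (induction J rule: infinite_finite_induct)
      (auto simp: zero contract_add[OF assms(2)] contract_scale[OF assms(2)] subspace_scale
        subspace_sum assms(1))
  then show ?thesis by (simp add: contract_def)
qed

text \<open>On lists from \<open>B\<close> the pigeonhole principle forces a repetition;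
  multilinearity carries this to the span.\<close>

lemma alternating_zero_above_dimension:
  fixes B :: "'a::real_vector set"
  assumes \<alpha>: "\<alpha> \<in> alternating_forms (span B)" and B: "finite B" "card B < length vs"
  shows "\<alpha> vs = 0"
proof -
  have basis: "\<alpha> xs = 0" if "set xs \<subseteq> B" "length xs = length vs" for xs
  proof -
    have "\<not> distinct xs"
      using that B card_mono[OF B(1) that(1)] by (auto dest: distinct_card)
    then obtain i j where "i < j" "j < length xs" "xs ! i = xs ! j"
      by (metis distinct_conv_nth nat_neq_iff)
    moreover have "set xs \<subseteq> span B" using that(1) span_superset by blast
    ultimately show ?thesis using \<alpha> unfolding alternating_forms_def by blast
  qed
  \<comment> \<open>Linearity in an inner argument: contract by the prefix until that argument comes
    first.\<close>
  have front: "\<alpha> (xs @ (u + v) # ys) = \<alpha> (xs @ u # ys) + \<alpha> (xs @ v # ys) \<and>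
      \<alpha> (xs @ (c *\<^sub>R u) # ys) = c * \<alpha> (xs @ u # ys)"
    if "set (xs @ ys) \<subseteq> span B" "u \<in> span B" "v \<in> span B" for xs ys u v c
    using that \<alpha>
  proof (induction xs arbitrary: \<alpha>)
    case Nil
    then show ?case by (simp add: alternating_forms_add_Cons alternating_forms_scale_Cons)
  next
    case (Cons x xs)
    then have "contract x \<alpha> \<in> alternating_forms (span B)" by (simp add: contract_alternating)
    then show ?case
      using Cons.IH[of "contract x \<alpha>"] Cons.prems by (simp add: contract_def[abs_def])
  qed
  \<comment> \<open>\<open>xs\<close> collects the arguments already reduced to elements of
    \<open>B\<close>; those in \<open>ys\<close> are still arbitrary vectors of the span.\<close>
  have "\<alpha> (xs @ ys) = 0" if "set xs \<subseteq> B" "set ys \<subseteq> span B" "length (xs @ ys) = length vs" for xs ys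
    using that
  proof (induction ys arbitrary: xs)
    case Nil
    then show ?case using basis by simp
  next
    case (Cons y ys)
    have xs: "set (xs @ ys) \<subseteq> span B" using Cons.prems span_superset by auto
    have "y \<in> span B" using Cons.prems by simp
    then have "y \<in> span B \<and> \<alpha> (xs @ y # ys) = 0"
    proof (induction rule: span_induct_alt)
      case base
      then show ?case using front[OF xs, of 0 0 0] by (simp add: span_zero)
    next
      case (step c x y)
      have "\<alpha> (xs @ x # ys) = 0"
        using Cons.IH[of "xs @ [x]"] Cons.prems step by simp
      then show ?case
        using front[OF xs, of "c *\<^sub>R x" y] front[OF xs, of x 0 c] step
        by (simp add: span_add span_base span_scale span_zero)
    qed
    then show ?case ..
  qed
  from this[of "[]" vs] show ?thesis
    using alternating_forms_outside[OF \<alpha>] by (cases "set vs \<subseteq> span B") auto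
qed

text \<open>The dual basis covector of \<open>b\<close>. Off the span \<open>representation\<close>
  is 0, in agreement with the convention for meaningless arguments.\<close>

definition coordinate :: "'a::real_vector set \<Rightarrow> 'a \<Rightarrow> 'a list \<Rightarrow> real" where
  "coordinate B b vs = (if length vs = 1 then representation B (hd vs) b else 0)"

lemma coordinate_alternating:
  assumes "independent B"
  shows "coordinate B b \<in> alternating_forms (span B)"
proof (rule alternating_formsI)
  show "coordinate B b vs = 0" if "\<not> set vs \<subseteq> span B" for vs
    using that by (cases vs) (auto simp: coordinate_def representation_def)
  show "coordinate B b (xs @ (u + v) # ys) = coordinate B b (xs @ u # ys) + coordinate B b (xs @ v # ys)"
    if "u \<in> span B" "v \<in> span B" for xs ys u v
    using that assms by (cases xs) (auto simp: coordinate_def representation_add)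
  show "coordinate B b (xs @ (c *\<^sub>R u) # ys) = c * coordinate B b (xs @ u # ys)"
    if "u \<in> span B" for xs ys u c
    using that assms by (cases xs) (auto simp: coordinate_def representation_scale)
qed (auto simp: coordinate_def)

lemma lwedge_scalar: "lwedge (\<lambda>vs. if vs = [] then c else 0) \<beta> = (\<lambda>vs. c * \<beta> vs)"
proof
  have "contract v (\<lambda>vs. if vs = [] then c else 0) = (\<lambda>_. 0)" for v :: 'a
    by (simp add: contract_def fun_eq_iff)
  moreover have "parity_twist (\<lambda>vs. if vs = [] then c else 0) = (\<lambda>vs :: 'a list. if vs = [] then c else 0)"
    by (auto simp: parity_twist_def fun_eq_iff)
  ultimately show "lwedge (\<lambda>vs. if vs = [] then c else 0) \<beta> vs = c * \<beta> vs" for vs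
    by (induction vs arbitrary: \<beta>) (simp_all add: lwedge_Cons contract_def)
qed

text \<open>Expanding an alternating form along a basis and its dual basis; each of the arguments
  contributes one summand.\<close>

lemma sum_coordinate_wedge_contract:
  fixes \<alpha> :: "'a::real_vector list \<Rightarrow> real"
  assumes B: "independent B" "finite B" and \<alpha>: "\<alpha> \<in> alternating_forms (span B)"
  shows "(\<Sum>b\<in>B. lwedge (coordinate B b) (contract b \<alpha>) vs) = length vs * \<alpha> vs"
  using \<alpha>
proof (induction vs arbitrary: \<alpha>)
  case Nil
  then show ?case by (simp add: coordinate_def)
next
  case (Cons v vs)
  show ?case
  proof (cases "v \<in> span B")
    case False
    then have "\<alpha> (v # vs) = 0"
      using Cons.prems by (intro alternating_forms_outside) auto
    moreover have "lwedge (coordinate B b) (contract b \<alpha>) (v # vs) = 0" if "b \<in> B" for b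
    proof (rule alternating_forms_outside)
      show "lwedge (coordinate B b) (contract b \<alpha>) \<in> alternating_forms (span B)"
        using that Cons.prems B
        by (intro lwedge_alternating coordinate_alternating contract_alternating) (auto simp: span_base)
    qed (use False in auto)
    ultimately show ?thesis by simp
  next
    case True
    have c1: "contract v (coordinate B b) = (\<lambda>vs. if vs = [] then representation B v b else 0)" for b
      by (auto simp: contract_def coordinate_def fun_eq_iff)
    have c2: "parity_twist (coordinate B b) = (\<lambda>vs. - 1 * coordinate B b vs)" for b
      by (auto simp: parity_twist_def coordinate_def fun_eq_iff)
    have c3: "contract v (contract b \<alpha>) = (\<lambda>vs. - 1 * contract b (contract v \<alpha>) vs)" if "b \<in> B" for b
      using contract_swap[OF subspace_span Cons.prems True span_base[OF that]] .
    \<comment> \<open>The new argument either enters the covector, which yields its expansion in the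
      basis, or passes on to \<alpha>. In the second case the sign of the twist cancels that of
      exchanging two contractions.\<close>
    have "(\<Sum>b\<in>B. lwedge (coordinate B b) (contract b \<alpha>) (v # vs)) =
        (\<Sum>b\<in>B. representation B v b * \<alpha> (b # vs)) +
        (\<Sum>b\<in>B. lwedge (coordinate B b) (contract b (contract v \<alpha>)) vs)"
      unfolding sum.distrib[symmetric]
      by (intro sum.cong refl, subst lwedge_Cons)
        (simp add: c1 c2 c3 lwedge_scalar contract_def[of _ \<alpha>]
          lwedge_scale_left[of "-1", simplified] lwedge_scale_right[of _ "-1", simplified])
    also have "(\<Sum>b\<in>B. representation B v b * \<alpha> (b # vs)) = \<alpha> ((\<Sum>b\<in>B. representation B v b *\<^sub>R b) # vs)"
      using Cons.prems by (intro alternating_sum_Cons[symmetric, of "span B"]) (auto simp: span_base)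
    also have "(\<Sum>b\<in>B. representation B v b *\<^sub>R b) = v"
      using True B by (intro sum_representation_eq) auto
    also have "(\<Sum>b\<in>B. lwedge (coordinate B b) (contract b (contract v \<alpha>)) vs) =
        length vs * contract v \<alpha> vs"
      using Cons.IH[OF contract_alternating[OF Cons.prems True]] .
    finally show ?thesis by (simp add: contract_def algebra_simps)
  qed
qed

section \<open>Forms on a vector bundle\<close>

definition fscale :: "real \<Rightarrow> ('m, 'a) form \<Rightarrow> ('m, 'a) form" where
  "fscale c \<omega> = (\<lambda>p vs. c * \<omega> p vs)"

lemma fscale_apply [simp]: "fscale c \<omega> p vs = c * \<omega> p vs"
  by (simp add: fscale_def)

lemma fscale_add: "fscale c (\<alpha> + \<beta>) = fscale c \<alpha> + fscale c \<beta>"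
  and fscale_fscale [simp]: "fscale c (fscale d \<alpha>) = fscale (c * d) \<alpha>"
  and fscale_1 [simp]: "fscale 1 \<alpha> = \<alpha>"
  and fscale_0 [simp]: "fscale 0 \<alpha> = 0"
  and fscale_zero [simp]: "fscale c 0 = 0"
  by (simp_all add: fun_eq_iff algebra_simps)

lemma wedge_add_left: "wedge (\<alpha> + \<alpha>') \<beta> = wedge \<alpha> \<beta> + wedge \<alpha>' \<beta>"
  by (simp add: fun_eq_iff wedge_eq_lwedge lwedge_add_left)

lemma wedge_add_right: "wedge \<alpha> (\<beta> + \<beta>') = wedge \<alpha> \<beta> + wedge \<alpha> \<beta>'"
  by (simp add: fun_eq_iff wedge_eq_lwedge lwedge_add_right)

lemma wedge_fscale_left: "wedge (fscale c \<alpha>) \<beta> = fscale c (wedge \<alpha> \<beta>)"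
  by (simp add: fun_eq_iff wedge_eq_lwedge fscale_def lwedge_scale_left)

lemma wedge_fscale_right: "wedge \<alpha> (fscale c \<beta>) = fscale c (wedge \<alpha> \<beta>)"
  by (simp add: fun_eq_iff wedge_eq_lwedge fscale_def lwedge_scale_right)

lemma wedge_zero_left [simp]: "wedge 0 \<beta> = 0"
  and wedge_zero_right [simp]: "wedge \<alpha> 0 = 0"
  by (simp_all add: fun_eq_iff wedge_eq_lwedge zero_fun_def)

lemma wedge_assoc: "wedge (wedge \<alpha> \<beta>) \<gamma> = wedge \<alpha> (wedge \<beta> \<gamma>)"
  by (simp add: fun_eq_iff wedge_eq_lwedge lwedge_assoc)

lemma sum_form_apply: "(\<Sum>i\<in>I. (\<alpha> i :: ('m, 'a) form)) p vs = (\<Sum>i\<in>I. \<alpha> i p vs)"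
  by (induction I rule: infinite_finite_induct) simp_all

lemma component_apply [simp]:
  "component k \<omega> p vs = (if int (length vs) = k then \<omega> p vs else 0)"
  by (simp add: component_def)

lemma forms_degD:
  "\<omega> \<in> forms_deg A k \<Longrightarrow> \<omega> \<in> forms A"
  "\<omega> \<in> forms_deg A k \<Longrightarrow> int (length vs) \<noteq> k \<Longrightarrow> \<omega> p vs = 0"
  by (auto simp: forms_deg_def fun_eq_iff split: if_splits)

lemma forms_degI:
  "\<omega> \<in> forms A \<Longrightarrow> (\<And>p vs. int (length vs) \<noteq> k \<Longrightarrow> \<omega> p vs = 0) \<Longrightarrow> \<omega> \<in> forms_deg A k"
  by (auto simp: forms_deg_def fun_eq_iff)

lemma forms_deg_negative: "\<omega> \<in> forms_deg A k \<Longrightarrow> k < 0 \<Longrightarrow> \<omega> = 0"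
  using forms_degD(2) by (fastforce simp: fun_eq_iff)

text \<open>Negative degrees contain only 0; otherwise the iterated twist acts on the homogeneous
  \<beta> as a scalar.\<close>

lemma wedge_graded_commute:
  assumes \<alpha>: "\<alpha> \<in> forms_deg A k" and \<beta>: "\<beta> \<in> forms_deg A l"
  shows "wedge \<alpha> \<beta> = fscale ((-1) powi (k * l)) (wedge \<beta> \<alpha>)"
proof (cases "k < 0 \<or> l < 0")
  case True
  then show ?thesis using forms_deg_negative[OF \<alpha>] forms_deg_negative[OF \<beta>] by auto
next
  case False
  then obtain m n where mn: "k = int m" "l = int n" by (metis int_nat_eq not_le)
  have twist: "(parity_twist ^^ i) (\<beta> p) = (\<lambda>vs. (-1) ^ (i * n) * \<beta> p vs)" for i p
  proof (induction i)
    case (Suc i)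
    show ?case
    proof
      fix vs show "(parity_twist ^^ Suc i) (\<beta> p) vs = (-1) ^ (Suc i * n) * \<beta> p vs"
        using forms_degD(2)[OF \<beta>, of vs p] mn
        by (cases "length vs = n") (simp_all add: Suc.IH parity_twist_def power_add)
    qed
  qed simp
  have "wedge \<alpha> \<beta> p vs = (-1) ^ (m * n) * wedge \<beta> \<alpha> p vs" for p vs
  proof -
    have "wedge \<alpha> \<beta> p vs = lwedge ((parity_twist ^^ m) (\<beta> p)) (\<alpha> p) vs"
      unfolding wedge_eq_lwedge using forms_degD(2)[OF \<alpha>] mn
      by (intro lwedge_graded_commute) auto
    then show ?thesis by (simp add: twist lwedge_scale_left wedge_eq_lwedge)
  qed
  moreover have "(-1) powi (k * l) = (-1 :: real) ^ (m * n)"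
    unfolding mn of_nat_mult[symmetric] power_int_of_nat ..
  ultimately show ?thesis by (simp add: fun_eq_iff)
qed

definition of_fun :: "('m \<Rightarrow> real) \<Rightarrow> ('m, 'a) form" where
  "of_fun f = (\<lambda>p vs. if vs = [] then f p else 0)"

lemma wedge_of_fun: "wedge (of_fun f) \<omega> = (\<lambda>p vs. f p * \<omega> p vs)"
  by (simp add: fun_eq_iff wedge_eq_lwedge of_fun_def lwedge_scalar)

locale smooth_vector_bundle =
  fixes A :: "('m, 'e::{real_inner,heine_borel}, 'a::real_vector, 'z) vbundle_scheme"
  assumes vbundle: "vector_bundle A"
begin

lemma manifold: "smooth_manifold A"
  using vbundle by (simp add: vector_bundle_def)

lemma frame_openin: "(U, e) \<in> frames A \<Longrightarrow> openin (base A) U"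
  using vbundle unfolding vector_bundle_def by blast

lemma frame_basis:
  assumes "(U, e) \<in> frames A" "p \<in> U"
  shows "inj_on (\<lambda>i. e i p) {..<brank A}" "independent ((\<lambda>i. e i p) ` {..<brank A})"
    "span ((\<lambda>i. e i p) ` {..<brank A}) = fibre A p"
  using vbundle assms unfolding vector_bundle_def by blast+

lemma frame_at:
  assumes "p \<in> topspace (base A)"
  obtains U e where "(U, e) \<in> frames A" "p \<in> U"
proof -
  have "(\<Union>(U, e)\<in>frames A. U) = topspace (base A)"
    using vbundle by (simp only: vector_bundle_def)
  then show ?thesis using assms that by blast
qed

lemma frame_transition:
  assumes "(U, e) \<in> frames A" "(U', e') \<in> frames A"
  obtains g where "\<forall>i<brank A. \<forall>j<brank A. smooth_fun A (U \<inter> U') (g i j)"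
    "\<forall>p\<in>U \<inter> U'. \<forall>j<brank A. e' j p = (\<Sum>i<brank A. g i j p *\<^sub>R e i p)"
proof -
  have "\<forall>(U, e)\<in>frames A. \<forall>(U', e')\<in>frames A. \<exists>g.
        (\<forall>i<brank A. \<forall>j<brank A. smooth_fun A (U \<inter> U') (g i j)) \<and>
        (\<forall>p\<in>U \<inter> U'. \<forall>j<brank A. e' j p = (\<Sum>i<brank A. g i j p *\<^sub>R e i p))"
    using vbundle unfolding vector_bundle_def by (elim conjE)
  from bspec[OF bspec[OF this assms(1), simplified] assms(2)]
  have "\<exists>g. (\<forall>i<brank A. \<forall>j<brank A. smooth_fun A (U \<inter> U') (g i j)) \<and>
        (\<forall>p\<in>U \<inter> U'. \<forall>j<brank A. e' j p = (\<Sum>i<brank A. g i j p *\<^sub>R e i p))"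
    by simp
  then show ?thesis using that by blast
qed

lemma subspace_fibre: "p \<in> topspace (base A) \<Longrightarrow> subspace (fibre A p)"
  using frame_at frame_basis(3) subspace_span by metis

lemma frame_in_fibre: "(U, e) \<in> frames A \<Longrightarrow> p \<in> U \<Longrightarrow> i < brank A \<Longrightarrow> e i p \<in> fibre A p"
  using frame_basis(3)[of U e p] span_base[of "e i p" "(\<lambda>i. e i p) ` {..<brank A}"] by auto

lemma formsI:
  assumes "\<And>p. p \<notin> topspace (base A) \<Longrightarrow> \<omega> p = (\<lambda>_. 0)"
    and "\<And>p. p \<in> topspace (base A) \<Longrightarrow> \<omega> p \<in> alternating_forms (fibre A p)"
    and "\<And>U e ks. (U, e) \<in> frames A \<Longrightarrow> set ks \<subseteq> {..<brank A} \<Longrightarrow>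
      smooth_fun A U (\<lambda>p. \<omega> p (map (\<lambda>i. e i p) ks))"
  shows "\<omega> \<in> forms A"
  using assms unfolding forms_def mem_Collect_eq by blast

lemma formsD:
  assumes "\<omega> \<in> forms A"
  shows "p \<notin> topspace (base A) \<Longrightarrow> \<omega> p = (\<lambda>_. 0)"
    and "p \<in> topspace (base A) \<Longrightarrow> \<omega> p \<in> alternating_forms (fibre A p)"
    and "(U, e) \<in> frames A \<Longrightarrow> set ks \<subseteq> {..<brank A} \<Longrightarrow>
      smooth_fun A U (\<lambda>p. \<omega> p (map (\<lambda>i. e i p) ks))"
  using assms unfolding forms_def mem_Collect_eq by blast+

lemma zero_form: "0 \<in> forms A"
  by (rule formsI) (auto simp: zero_alternating zero_fun_def smooth_fun_const[OF manifold])

lemma forms_add: "\<alpha> \<in> forms A \<Longrightarrow> \<beta> \<in> forms A \<Longrightarrow> \<alpha> + \<beta> \<in> forms A"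
  by (rule formsI)
    (auto simp: plus_fun_def formsD
      intro!: alternating_forms_plus smooth_fun_add[OF manifold] frame_openin)

lemma forms_fscale: "\<alpha> \<in> forms A \<Longrightarrow> fscale c \<alpha> \<in> forms A"
  by (rule formsI)
    (auto simp: fscale_def formsD
      intro!: alternating_forms_times smooth_fun_mult[OF manifold] smooth_fun_const[OF manifold]
        frame_openin)

lemma forms_sum: "(\<And>i. i \<in> I \<Longrightarrow> \<alpha> i \<in> forms A) \<Longrightarrow> (\<Sum>i\<in>I. \<alpha> i) \<in> forms A"
  by (induction I rule: infinite_finite_induct) (auto intro: forms_add zero_form)

lemma forms_wedge:
  assumes "\<alpha> \<in> forms A" "\<beta> \<in> forms A"
  shows "wedge \<alpha> \<beta> \<in> forms A"
proof (rule formsI)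
  show "wedge \<alpha> \<beta> p = (\<lambda>_. 0)" if "p \<notin> topspace (base A)" for p
    using that assms by (simp add: wedge_eq_lwedge formsD(1))
  show "wedge \<alpha> \<beta> p \<in> alternating_forms (fibre A p)" if "p \<in> topspace (base A)" for p
    using that assms by (simp add: wedge_eq_lwedge lwedge_alternating subspace_fibre formsD(2))
  fix U e ks assume f: "(U, e) \<in> frames A" "set ks \<subseteq> {..<brank A}"
  have "set (nths ks S) \<subseteq> {..<brank A}" for S
    using f(2) set_nths_subset by fastforce
  then show "smooth_fun A U (\<lambda>p. wedge \<alpha> \<beta> p (map (\<lambda>i. e i p) ks))"
    unfolding wedge_def nths_map length_map
    by (intro smooth_fun_sum[OF manifold] smooth_fun_mult[OF manifold] smooth_fun_const[OF manifold]
        frame_openin[OF f(1)] formsD(3)[OF _ f(1)] assms) auto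
qed

lemma forms_component: "\<omega> \<in> forms A \<Longrightarrow> component k \<omega> \<in> forms A"
proof (rule formsI)
  assume \<omega>: "\<omega> \<in> forms A"
  have *: "component k \<omega> p = (\<lambda>vs. (if int (length vs) = k then 1 else 0) * \<omega> p vs)" for p
    by (auto simp: fun_eq_iff)
  show "component k \<omega> p = (\<lambda>_. 0)" if "p \<notin> topspace (base A)" for p
    using that \<omega> by (simp add: * formsD(1))
  show "component k \<omega> p \<in> alternating_forms (fibre A p)" if "p \<in> topspace (base A)" for p
    unfolding *
    by (rule alternating_forms_length_times[OF formsD(2)[OF \<omega> that], of "\<lambda>n. if int n = k then 1 else 0"])
  show "smooth_fun A U (\<lambda>p. component k \<omega> p (map (\<lambda>i. e i p) ks))"
    if "(U, e) \<in> frames A" "set ks \<subseteq> {..<brank A}" for U e ks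
    using formsD(3)[OF \<omega> that] smooth_fun_const[OF manifold, of U 0]
    by (cases "int (length ks) = k") simp_all
qed

lemma component_in_forms_deg: "\<omega> \<in> forms A \<Longrightarrow> component k \<omega> \<in> forms_deg A k"
  by (rule forms_degI) (auto simp: forms_component)

text \<open>Membership in \<open>forms\<close> never compares lists of different lengths. This
  serves for forms that are known only degree by degree.\<close>

lemma forms_if_components:
  assumes "\<And>k. component k \<omega> \<in> forms A"
  shows "\<omega> \<in> forms A"
proof (rule formsI)
  have eq: "\<omega> p vs = component (int (length vs)) \<omega> p vs" for p vs by simp
  show "\<omega> p = (\<lambda>_. 0)" if "p \<notin> topspace (base A)" for p
    by (rule ext, subst eq) (simp add: formsD(1)[OF assms that] del: component_apply)
  show "smooth_fun A U (\<lambda>p. \<omega> p (map (\<lambda>i. e i p) ks))"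
    if "(U, e) \<in> frames A" "set ks \<subseteq> {..<brank A}" for U e ks
    using formsD(3)[OF assms that, of "int (length ks)"] by simp
  show "\<omega> p \<in> alternating_forms (fibre A p)" if p: "p \<in> topspace (base A)" for p
  proof -
    have c: "component k \<omega> p \<in> alternating_forms (fibre A p)" for k
      by (rule formsD(2)[OF assms p])
    have 1: "\<omega> p vs = 0" if "\<not> set vs \<subseteq> fibre A p" for vs
      using alternating_formsD(1)[OF c[of "int (length vs)"] that] by simp
    have 2: "\<omega> p (vs[i := u + v]) = \<omega> p (vs[i := u]) + \<omega> p (vs[i := v])"
      if "set vs \<subseteq> fibre A p" "i < length vs" "u \<in> fibre A p" "v \<in> fibre A p" for vs i u v
      using alternating_formsD(2)[OF c[of "int (length vs)"] that] by simp
    have 3: "\<omega> p (vs[i := c *\<^sub>R u]) = c * \<omega> p (vs[i := u])"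
      if "set vs \<subseteq> fibre A p" "i < length vs" "u \<in> fibre A p" for vs i u c
      using alternating_formsD(3)[OF c[of "int (length vs)"] that] by simp
    have 4: "\<omega> p vs = 0"
      if "set vs \<subseteq> fibre A p" "i < j" "j < length vs" "vs ! i = vs ! j" for vs i j
      using alternating_formsD(4)[OF c[of "int (length vs)"] that] by simp
    show ?thesis unfolding alternating_forms_def mem_Collect_eq using 1 2 3 4 by blast
  qed
qed

lemma forms_zero_above_rank:
  assumes "\<omega> \<in> forms A" "brank A < length vs"
  shows "\<omega> p vs = 0"
proof (cases "p \<in> topspace (base A)")
  case True
  then obtain U e where f: "(U, e) \<in> frames A" "p \<in> U" by (rule frame_at)
  have "card ((\<lambda>i. e i p) ` {..<brank A}) \<le> brank A"
    using card_image_le[of "{..<brank A}"] by simp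
  then show ?thesis
    using formsD(2)[OF assms(1) True] assms(2) frame_basis(3)[OF f]
    by (intro alternating_zero_above_dimension[of _ "(\<lambda>i. e i p) ` {..<brank A}"]) auto
qed (simp add: formsD(1)[OF assms(1)])

lemma forms_eq_sum_components:
  assumes "\<omega> \<in> forms A"
  shows "\<omega> = (\<Sum>k\<le>brank A. component (int k) \<omega>)"
proof (intro ext)
  fix p vs
  show "\<omega> p vs = (\<Sum>k\<le>brank A. component (int k) \<omega>) p vs"
    using forms_zero_above_rank[OF assms, of vs p]
    by (cases "length vs \<le> brank A") (simp_all add: sum_form_apply if_distrib cong: if_cong)
qed

lemma forms_deg_above_rank: "\<omega> \<in> forms_deg A k \<Longrightarrow> int (brank A) < k \<Longrightarrow> \<omega> = 0"
  using forms_degD forms_zero_above_rank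
  by (metis (no_types, opaque_lifting) ext int_ops(1) of_nat_less_iff zero_fun_apply)

lemma forms_deg_add: "\<alpha> \<in> forms_deg A k \<Longrightarrow> \<beta> \<in> forms_deg A k \<Longrightarrow> \<alpha> + \<beta> \<in> forms_deg A k"
  by (rule forms_degI) (auto simp: forms_add forms_degD)

lemma forms_deg_fscale: "\<alpha> \<in> forms_deg A k \<Longrightarrow> fscale c \<alpha> \<in> forms_deg A k"
  by (rule forms_degI) (auto simp: forms_fscale forms_degD)

lemma forms_deg_wedge:
  assumes "\<alpha> \<in> forms_deg A k" "\<beta> \<in> forms_deg A l"
  shows "wedge \<alpha> \<beta> \<in> forms_deg A (k + l)"
proof (rule forms_degI)
  show "wedge \<alpha> \<beta> \<in> forms A" using assms by (simp add: forms_wedge forms_degD)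
  fix p and vs :: "'a list" assume len: "int (length vs) \<noteq> k + l"
  have "\<alpha> p (nths vs S) * \<beta> p (nths vs ({..<length vs} - S)) = 0" if "S \<in> Pow {..<length vs}" for S
  proof -
    have S: "S \<subseteq> {..<length vs}" using that by simp
    then have "{i. i < length vs \<and> i \<in> S} = S" by auto
    moreover have "{i. i < length vs \<and> i \<in> {..<length vs} - S} = {..<length vs} - S" by auto
    ultimately have "length (nths vs S) = card S"
      "length (nths vs ({..<length vs} - S)) = length vs - card S"
      using S finite_subset[OF S] by (simp_all add: length_nths card_Diff_subset)
    moreover have "card S \<le> length vs" using card_mono[OF _ S] by simp
    ultimately have "int (length (nths vs S)) \<noteq> k \<or>
        int (length (nths vs ({..<length vs} - S))) \<noteq> l"
      using len by auto
    then show ?thesis using assms forms_degD(2) by fastforce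
  qed
  then show "wedge \<alpha> \<beta> p vs = 0"
    unfolding wedge_def mult.assoc by (intro sum.neutral) simp
qed

lemma of_fun_forms_deg:
  assumes "smooth_fun A (topspace (base A)) f" "\<And>p. p \<notin> topspace (base A) \<Longrightarrow> f p = 0"
  shows "of_fun f \<in> forms_deg A 0"
proof (intro forms_degI formsI)
  show "of_fun f p \<in> alternating_forms (fibre A p)" for p
    by (auto simp: of_fun_def alternating_forms_def)
  show "smooth_fun A U (\<lambda>p. of_fun f p (map (\<lambda>i. e i p) ks))" if "(U, e) \<in> frames A" for U e ks
    using smooth_fun_subset[OF manifold assms(1) openin_subset[OF frame_openin[OF that]]]
      smooth_fun_const[OF manifold, of U 0]
    by (cases "ks = []") (simp_all add: of_fun_def)
qed (use assms in \<open>auto simp: of_fun_def\<close>)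

text \<open>Not a form of degree 1 but the unit of the algebra, the constant function 1. The cut-off
  is forced because forms are 0 off the base.\<close>

definition one_form :: "('m, 'a) form" where
  "one_form = of_fun (\<lambda>p. if p \<in> topspace (base A) then 1 else 0)"

lemma one_form_forms_deg: "one_form \<in> forms_deg A 0"
  unfolding one_form_def
  by (rule of_fun_forms_deg)
    (auto intro: smooth_fun_cong[OF manifold openin_topspace _ smooth_fun_const[OF manifold, of _ 1]])

lemma wedge_one_form: "\<omega> \<in> forms A \<Longrightarrow> wedge one_form \<omega> = \<omega>"
  by (auto simp: fun_eq_iff one_form_def wedge_of_fun formsD(1))

text \<open>A frame domain is covered by its part in \<open>U\<close>, where smoothness is assumed,
  and its part off \<open>K\<close>, where the form is 0; both are open.\<close>

lemma forms_extend_by_zero: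
  assumes f: "(U, e) \<in> frames A" and K: "closedin (base A) K" "K \<subseteq> U"
    and outside: "\<And>p. p \<notin> K \<Longrightarrow> \<omega> p = (\<lambda>_. 0)"
    and alternating: "\<And>p. p \<in> U \<Longrightarrow> \<omega> p \<in> alternating_forms (fibre A p)"
    and smooth: "\<And>U' e' ks. (U', e') \<in> frames A \<Longrightarrow> set ks \<subseteq> {..<brank A} \<Longrightarrow>
      smooth_fun A (U \<inter> U') (\<lambda>p. \<omega> p (map (\<lambda>i. e' i p) ks))"
  shows "\<omega> \<in> forms A"
proof (rule formsI)
  show "\<omega> p = (\<lambda>_. 0)" if "p \<notin> topspace (base A)" for p
    using that K openin_subset[OF frame_openin[OF f]] outside by blast
  show "\<omega> p \<in> alternating_forms (fibre A p)" for p
    using alternating[of p] outside[of p] K(2) zero_alternating by fastforce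
  fix U' e' ks assume f': "(U', e') \<in> frames A" and ks: "set ks \<subseteq> {..<brank A}"
  have op: "openin (base A) (U \<inter> U')" "openin (base A) (U' - K)"
    using frame_openin[OF f] frame_openin[OF f'] K(1) by auto
  have "smooth_fun A (U' - K) (\<lambda>p. \<omega> p (map (\<lambda>i. e' i p) ks))"
    using outside by (intro smooth_fun_cong[OF manifold op(2) _ smooth_fun_const[OF manifold, of _ 0]]) auto
  then have "smooth_fun A ((U \<inter> U') \<union> (U' - K)) (\<lambda>p. \<omega> p (map (\<lambda>i. e' i p) ks))"
    by (intro smooth_fun_Un[OF manifold] op smooth[OF f' ks])
  moreover have "(U \<inter> U') \<union> (U' - K) = U'" using K(2) by auto
  ultimately show "smooth_fun A U' (\<lambda>p. \<omega> p (map (\<lambda>i. e' i p) ks))" by simp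
qed

text \<open>The identity \<open>sum_coordinate_wedge_contract\<close> in the frame \<open>e\<close>,
  with one factor \<open>h\<close> on the covectors and one on the contractions, so that each
  extends by zero. The factor \<open>k\<close> counts the arguments.\<close>

lemma local_decomposition:
  assumes f: "(U, e) \<in> frames A" and K: "closedin (base A) K" "K \<subseteq> U"
    and h: "smooth_fun A (topspace (base A)) h" "\<And>p. p \<notin> K \<Longrightarrow> h p = 0"
    and \<omega>: "\<omega> \<in> forms_deg A k"
  obtains \<theta> \<eta> where "\<And>i. i < brank A \<Longrightarrow> \<theta> i \<in> forms_deg A 1"
    "\<And>i. i < brank A \<Longrightarrow> \<eta> i \<in> forms_deg A (k - 1)"
    "(\<Sum>i<brank A. wedge (\<theta> i) (\<eta> i)) = fscale (of_int k) (wedge (of_fun h) (wedge (of_fun h) \<omega>))"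
proof -
  define B where "B p = (\<lambda>i. e i p) ` {..<brank A}" for p
  define \<theta> where "\<theta> i = (\<lambda>p vs. h p * coordinate (B p) (e i p) vs)" for i
  define \<eta> where "\<eta> i = (\<lambda>p vs. h p * contract (e i p) (\<omega> p) vs)" for i
  have U_top: "U \<subseteq> topspace (base A)" using openin_subset[OF frame_openin[OF f]] .
  have \<omega>': "\<omega> \<in> forms A" using \<omega> forms_degD(1) by blast
  have op: "openin (base A) (U \<inter> U')" if "(U', e') \<in> frames A" for U' e'
    using frame_openin[OF f] frame_openin[OF that] by auto
  have hU: "smooth_fun A (U \<inter> U') h" for U'
    using smooth_fun_subset[OF manifold h(1)] U_top by blast
  have "\<theta> i \<in> forms A" if i: "i < brank A" for i
  proof (rule forms_extend_by_zero[OF f K])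
    show "\<theta> i p = (\<lambda>_. 0)" if "p \<notin> K" for p using h(2)[OF that] by (simp add: \<theta>_def)
    show "\<theta> i p \<in> alternating_forms (fibre A p)" if "p \<in> U" for p
      using coordinate_alternating[OF frame_basis(2)[OF f that]] frame_basis(3)[OF f that]
      unfolding \<theta>_def B_def by (intro alternating_forms_times) simp
    fix U' e' ks assume f': "(U', e') \<in> frames A" and ks: "set ks \<subseteq> {..<brank A}"
    \<comment> \<open>The values of the dual frame of \<open>e\<close> on \<open>e'\<close> are the
      entries of the matrix that expresses \<open>e'\<close> through \<open>e\<close>.\<close>
    obtain g where "\<forall>i<brank A. \<forall>j<brank A. smooth_fun A (U \<inter> U') (g i j)"
      "\<forall>p\<in>U \<inter> U'. \<forall>j<brank A. e' j p = (\<Sum>i<brank A. g i j p *\<^sub>R e i p)"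
      using frame_transition[OF f f'] .
    then have g: "\<And>i j. i < brank A \<Longrightarrow> j < brank A \<Longrightarrow> smooth_fun A (U \<inter> U') (g i j)"
      "\<And>p j. p \<in> U \<inter> U' \<Longrightarrow> j < brank A \<Longrightarrow> e' j p = (\<Sum>i<brank A. g i j p *\<^sub>R e i p)"
      by simp_all
    have rep: "representation (B p) (e' j p) (e i p) = g i j p"
      if p: "p \<in> U \<inter> U'" and j: "j < brank A" for p j
    proof -
      have inj: "inj_on (\<lambda>i. e i p) {..<brank A}" and ind: "independent (B p)"
        using frame_basis[OF f] p by (auto simp: B_def)
      have mem: "e l p \<in> B p" if "l < brank A" for l using that by (simp add: B_def)
      have "representation (B p) (e' j p) (e i p) =
          (\<Sum>l<brank A. g l j p * representation (B p) (e l p) (e i p))"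
        unfolding g(2)[OF p j]
        by (subst representation_sum[OF ind])
          (auto intro!: sum.cong simp: representation_scale[OF ind] span_base span_scale mem)
      also have "\<dots> = (\<Sum>l<brank A. g l j p * (if l = i then 1 else 0))"
        using inj_on_eq_iff[OF inj, of i] i
        by (intro sum.cong refl) (simp add: representation_basis[OF ind mem])
      also have "\<dots> = g i j p" using i by (simp add: if_distrib cong: if_cong)
      finally show ?thesis .
    qed
    show "smooth_fun A (U \<inter> U') (\<lambda>p. \<theta> i p (map (\<lambda>i. e' i p) ks))"
    proof (cases "length ks = 1")
      case True
      then obtain j where j: "ks = [j]" by (auto simp: length_Suc_conv)
      show ?thesis
        by (rule smooth_fun_cong[OF manifold op[OF f'] _
              smooth_fun_mult[OF manifold op[OF f'] hU g(1)[OF i, of j]]])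
          (use ks j in \<open>auto simp: \<theta>_def coordinate_def rep\<close>)
    qed (simp add: \<theta>_def coordinate_def smooth_fun_const[OF manifold])
  qed
  then have \<theta>: "\<theta> i \<in> forms_deg A 1" if "i < brank A" for i
    using that by (intro forms_degI) (auto simp: \<theta>_def coordinate_def)
  have "\<eta> i \<in> forms A" if i: "i < brank A" for i
  proof (rule forms_extend_by_zero[OF f K])
    show "\<eta> i p = (\<lambda>_. 0)" if "p \<notin> K" for p using h(2)[OF that] by (simp add: \<eta>_def)
    show "\<eta> i p \<in> alternating_forms (fibre A p)" if "p \<in> U" for p
      using formsD(2)[OF \<omega>', of p] frame_in_fibre[OF f that i] U_top that
      unfolding \<eta>_def by (intro alternating_forms_times contract_alternating) auto
    fix U' e' ks assume f': "(U', e') \<in> frames A" and ks: "set ks \<subseteq> {..<brank A}"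
    \<comment> \<open>Here the opposite transition is required: the contracted vector of
      \<open>e\<close> is expanded in \<open>e'\<close>, on which \<omega> is known to have smooth
      values.\<close>
    obtain g where "\<forall>i<brank A. \<forall>j<brank A. smooth_fun A (U' \<inter> U) (g i j)"
      "\<forall>p\<in>U' \<inter> U. \<forall>j<brank A. e j p = (\<Sum>i<brank A. g i j p *\<^sub>R e' i p)"
      using frame_transition[OF f' f] .
    then have g: "\<And>i j. i < brank A \<Longrightarrow> j < brank A \<Longrightarrow> smooth_fun A (U' \<inter> U) (g i j)"
      "\<And>p j. p \<in> U' \<inter> U \<Longrightarrow> j < brank A \<Longrightarrow> e j p = (\<Sum>i<brank A. g i j p *\<^sub>R e' i p)"
      by simp_all
    have "h p * (\<Sum>j<brank A. g j i p * \<omega> p (map (\<lambda>i. e' i p) (j # ks))) =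
        \<eta> i p (map (\<lambda>i. e' i p) ks)" if p: "p \<in> U \<inter> U'" for p
    proof -
      have "\<omega> p ((\<Sum>j<brank A. g j i p *\<^sub>R e' j p) # map (\<lambda>i. e' i p) ks) =
          (\<Sum>j<brank A. g j i p * \<omega> p (e' j p # map (\<lambda>i. e' i p) ks))"
        using p U_top
        by (intro alternating_sum_Cons[OF subspace_fibre formsD(2)[OF \<omega>']] frame_in_fibre[OF f']) auto
      then show ?thesis using g(2)[of p i] p i by (simp add: \<eta>_def contract_def)
    qed
    moreover have "smooth_fun A (U \<inter> U')
        (\<lambda>p. h p * (\<Sum>j<brank A. g j i p * \<omega> p (map (\<lambda>i. e' i p) (j # ks))))"
    proof (intro smooth_fun_mult[OF manifold op[OF f']] hU smooth_fun_sum[OF manifold op[OF f']])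
      fix j assume j: "j \<in> {..<brank A}"
      then show "smooth_fun A (U \<inter> U') (g j i)" using g(1)[of j i] i by (simp add: Int_commute)
      show "smooth_fun A (U \<inter> U') (\<lambda>p. \<omega> p (map (\<lambda>i. e' i p) (j # ks)))"
        using smooth_fun_subset[OF manifold formsD(3)[OF \<omega>' f', of "j # ks"]] j ks by auto
    qed
    ultimately show "smooth_fun A (U \<inter> U') (\<lambda>p. \<eta> i p (map (\<lambda>i. e' i p) ks))"
      by (rule smooth_fun_cong[OF manifold op[OF f']])
  qed
  then have \<eta>: "\<eta> i \<in> forms_deg A (k - 1)" if "i < brank A" for i
    using that forms_degD(2)[OF \<omega>] by (intro forms_degI) (auto simp: \<eta>_def contract_def)
  have "(\<Sum>i<brank A. wedge (\<theta> i) (\<eta> i)) p vs =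
      fscale (of_int k) (wedge (of_fun h) (wedge (of_fun h) \<omega>)) p vs" for p vs
  proof (cases "p \<in> K")
    case False
    then show ?thesis using h(2)[of p]
      by (simp add: sum_form_apply wedge_eq_lwedge \<theta>_def wedge_of_fun)
  next
    case True
    then have p: "p \<in> U" using K by auto
    have "(\<Sum>i<brank A. wedge (\<theta> i) (\<eta> i)) p vs =
        (\<Sum>i<brank A. h p * h p * lwedge (coordinate (B p) (e i p)) (contract (e i p) (\<omega> p)) vs)"
      by (simp add: sum_form_apply wedge_eq_lwedge \<theta>_def \<eta>_def lwedge_scale_left lwedge_scale_right mult.assoc)
    also have "\<dots> = h p * h p * (\<Sum>b\<in>B p. lwedge (coordinate (B p) b) (contract b (\<omega> p)) vs)"
      unfolding B_def sum.reindex[OF frame_basis(1)[OF f p]] by (simp add: sum_distrib_left)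
    also have "\<dots> = h p * h p * (length vs * \<omega> p vs)"
      using sum_coordinate_wedge_contract[of "B p" "\<omega> p" vs] frame_basis[OF f p]
        formsD(2)[OF \<omega>', of p] p U_top by (auto simp: B_def)
    also have "\<dots> = fscale (of_int k) (wedge (of_fun h) (wedge (of_fun h) \<omega>)) p vs"
      using forms_degD(2)[OF \<omega>, of vs p] by (cases "int (length vs) = k") (auto simp: wedge_of_fun)
    finally show ?thesis .
  qed
  then show thesis using that[OF \<theta> \<eta>] by (simp add: fun_eq_iff)
qed

section \<open>Vector fields, the bracket and spans\<close>

lemma vector_fieldsD:
  assumes "X \<in> vector_fields A d"
  shows "\<omega> \<notin> forms A \<Longrightarrow> X \<omega> = 0"
    and "\<alpha> \<in> forms A \<Longrightarrow> \<beta> \<in> forms A \<Longrightarrow> X (\<alpha> + \<beta>) = X \<alpha> + X \<beta>"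
    and "\<alpha> \<in> forms A \<Longrightarrow> X (fscale c \<alpha>) = fscale c (X \<alpha>)"
    and "\<alpha> \<in> forms_deg A k \<Longrightarrow> X \<alpha> \<in> forms_deg A (k + d)"
    and "\<alpha> \<in> forms_deg A k \<Longrightarrow> \<beta> \<in> forms A \<Longrightarrow>
      X (wedge \<alpha> \<beta>) = wedge (X \<alpha>) \<beta> + fscale ((-1) powi (d * k)) (wedge \<alpha> (X \<beta>))"
  using assms unfolding vector_fields_def fscale_def mem_Collect_eq by blast+

lemma vector_fieldsI:
  assumes "\<And>\<omega>. \<omega> \<notin> forms A \<Longrightarrow> X \<omega> = 0"
    and "\<And>\<alpha> \<beta>. \<alpha> \<in> forms A \<Longrightarrow> \<beta> \<in> forms A \<Longrightarrow> X (\<alpha> + \<beta>) = X \<alpha> + X \<beta>"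
    and "\<And>\<alpha> c. \<alpha> \<in> forms A \<Longrightarrow> X (fscale c \<alpha>) = fscale c (X \<alpha>)"
    and "\<And>\<alpha> k. \<alpha> \<in> forms_deg A k \<Longrightarrow> X \<alpha> \<in> forms_deg A (k + d)"
    and "\<And>\<alpha> k \<beta>. \<alpha> \<in> forms_deg A k \<Longrightarrow> \<beta> \<in> forms A \<Longrightarrow>
      X (wedge \<alpha> \<beta>) = wedge (X \<alpha>) \<beta> + fscale ((-1) powi (d * k)) (wedge \<alpha> (X \<beta>))"
  shows "X \<in> vector_fields A d"
  using assms unfolding vector_fields_def fscale_def mem_Collect_eq by blast

text \<open>Elements of a span may be inhomogeneous and so lie in no
  \<open>vector_fields A d\<close>. This class contains them and still makes \<open>bracket\<close>
  biadditive.\<close>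

definition additive_operators :: "('m, 'a) operator set" where
  "additive_operators = {X. (\<forall>\<omega>. X \<omega> \<in> forms A) \<and> (\<forall>\<omega>. \<omega> \<notin> forms A \<longrightarrow> X \<omega> = 0) \<and>
     (\<forall>\<alpha>\<in>forms A. \<forall>\<beta>\<in>forms A. X (\<alpha> + \<beta>) = X \<alpha> + X \<beta>)}"

lemma additive_operatorsD:
  assumes "X \<in> additive_operators"
  shows "X \<omega> \<in> forms A" "\<omega> \<notin> forms A \<Longrightarrow> X \<omega> = 0"
    "\<alpha> \<in> forms A \<Longrightarrow> \<beta> \<in> forms A \<Longrightarrow> X (\<alpha> + \<beta>) = X \<alpha> + X \<beta>"
  using assms unfolding additive_operators_def mem_Collect_eq by blast+

lemma zero_additive_operator: "0 \<in> additive_operators"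
  by (simp add: additive_operators_def zero_form)

lemma additive_operators_add:
  "X \<in> additive_operators \<Longrightarrow> Y \<in> additive_operators \<Longrightarrow> X + Y \<in> additive_operators"
  by (auto simp: additive_operators_def forms_add)

lemma additive_operators_wedge:
  "f \<in> forms A \<Longrightarrow> X \<in> additive_operators \<Longrightarrow> (\<lambda>\<omega>. wedge f (X \<omega>)) \<in> additive_operators"
  by (simp add: additive_operators_def forms_wedge wedge_add_right)

lemma vector_field_zero: "X \<in> vector_fields A d \<Longrightarrow> X 0 = 0"
  using vector_fieldsD(3)[of X d 0 0] zero_form by simp

lemma vector_field_sum:
  assumes "X \<in> vector_fields A d" "\<And>i. i \<in> I \<Longrightarrow> \<alpha> i \<in> forms A"
  shows "X (\<Sum>i\<in>I. \<alpha> i) = (\<Sum>i\<in>I. X (\<alpha> i))"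
  using assms(2)
proof (induction I rule: infinite_finite_induct)
  case (insert i I)
  then have "X (\<alpha> i + (\<Sum>i\<in>I. \<alpha> i)) = X (\<alpha> i) + X (\<Sum>i\<in>I. \<alpha> i)"
    by (intro vector_fieldsD(2)[OF assms(1)] forms_sum) auto
  then show ?case using insert by (simp only: sum.insert insert_iff simp_thms)
qed (simp_all only: sum.infinite sum.empty vector_field_zero[OF assms(1)] not_False_eq_True)

lemma vector_field_decompose:
  assumes "X \<in> vector_fields A d" "\<omega> \<in> forms A"
  shows "X \<omega> = (\<Sum>k\<le>brank A. X (component (int k) \<omega>))"
  using vector_field_sum[OF assms(1), of "{..brank A}" "\<lambda>k. component (int k) \<omega>"]
    forms_component[OF assms(2)] forms_eq_sum_components[OF assms(2)] by metis

lemma vector_field_additive: "X \<in> vector_fields A d \<Longrightarrow> X \<in> additive_operators"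
proof -
  assume X: "X \<in> vector_fields A d"
  have "X \<omega> \<in> forms A" for \<omega>
  proof (cases "\<omega> \<in> forms A")
    case True
    show ?thesis
      unfolding vector_field_decompose[OF X True]
      by (intro forms_sum forms_degD(1)[OF vector_fieldsD(4)[OF X component_in_forms_deg[OF True]]])
  qed (simp add: vector_fieldsD(1)[OF X] zero_form)
  then show ?thesis
    using vector_fieldsD(1,2)[OF X] by (simp add: additive_operators_def)
qed

lemma vector_field_in_forms: "X \<in> vector_fields A d \<Longrightarrow> X \<omega> \<in> forms A"
  by (rule additive_operatorsD(1)[OF vector_field_additive])

lemma vector_field_eq_zeroI:
  assumes "X \<in> vector_fields A d"
    and "\<And>k \<omega>. \<omega> \<in> forms_deg A (int k) \<Longrightarrow> k \<le> brank A \<Longrightarrow> X \<omega> = 0"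
  shows "X = 0"
proof
  fix \<omega> show "X \<omega> = 0 \<omega>"
  proof (cases "\<omega> \<in> forms A")
    case True
    have "X \<omega> = 0"
      unfolding vector_field_decompose[OF assms(1) True]
      using assms(2)[OF component_in_forms_deg[OF True]] by (intro sum.neutral ballI) simp
    then show ?thesis by simp
  qed (simp add: vector_fieldsD(1)[OF assms(1)])
qed

text \<open>Nonzero homogeneous forms have degree between 0 and the rank, so such a shift leaves
  nothing. This justifies the finite range of degrees in \<open>bracket\<close>.\<close>

lemma vector_field_large_degree:
  assumes "X \<in> vector_fields A d" "int (brank A) < \<bar>d\<bar>"
  shows "X = 0"
proof (rule vector_field_eq_zeroI[OF assms(1)])
  fix k \<omega> assume \<omega>: "\<omega> \<in> forms_deg A (int k)" "k \<le> brank A"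
  note deg = vector_fieldsD(4)[OF assms(1) \<omega>(1)]
  have "int k + d < 0 \<or> int (brank A) < int k + d" using \<omega>(2) assms(2) by linarith
  then show "X \<omega> = 0"
    using forms_deg_negative[OF deg] forms_deg_above_rank[OF deg] by blast
qed

section \<open>Homogeneous components of operators, and the bracket\<close>

lemma component_add: "component k (\<alpha> + \<beta>) = component k \<alpha> + component k \<beta>"
  by (simp add: fun_eq_iff)

lemma component_op_component:
  "\<omega> \<in> forms A \<Longrightarrow> component k (op_component A i X \<omega>) = component k (X (component (k - i) \<omega>))"
  by (simp add: fun_eq_iff op_component_def)

text \<open>The input fed to \<open>X\<close> changes with the length of the argument list, so
  membership is checked one degree at a time.\<close>

lemma op_component_in_forms:
  assumes "X \<in> additive_operators"
  shows "op_component A i X \<omega> \<in> forms A"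
proof (cases "\<omega> \<in> forms A")
  case True
  have "component k (op_component A i X \<omega>) \<in> forms A" for k
    unfolding component_op_component[OF True]
    by (rule forms_component[OF additive_operatorsD(1)[OF assms]])
  then show ?thesis by (rule forms_if_components)
qed (simp add: op_component_def zero_form)

lemma op_component_add:
  assumes "X \<in> additive_operators" "\<alpha> \<in> forms A" "\<beta> \<in> forms A"
  shows "op_component A i X (\<alpha> + \<beta>) = op_component A i X \<alpha> + op_component A i X \<beta>"
  using assms
  by (simp add: op_component_def fun_eq_iff forms_add component_add forms_component
      additive_operatorsD(3)[OF assms(1)])

lemma op_component_plus: "op_component A i (X + Y) = op_component A i X + op_component A i Y"
  by (simp add: op_component_def fun_eq_iff)

text \<open>On lists of length \<open>k + d\<close>, the value of \<open>X \<omega>\<close> depends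
  only on the degree \<open>k\<close> part of \<omega>.\<close>

lemma op_component_homogeneous:
  assumes "X \<in> vector_fields A d"
  shows "op_component A i X = (if i = d then X else 0)"
proof
  fix \<omega>
  show "op_component A i X \<omega> = (if i = d then X else 0) \<omega>"
  proof (cases "\<omega> \<in> forms A")
    case True
    have comp: "X (component k \<omega>) p vs = (if int (length vs) = k + d then X \<omega> p vs else 0)" for k p vs
    proof -
      have deg: "X (component l \<omega>) \<in> forms_deg A (l + d)" for l
        by (rule vector_fieldsD(4)[OF assms component_in_forms_deg[OF True]])
      show ?thesis
      proof (cases "int (length vs) = k + d")
        case eq: True
        have "X \<omega> p vs = (\<Sum>l\<le>brank A. X (component (int l) \<omega>) p vs)"
          unfolding vector_field_decompose[OF assms True] sum_form_apply ..
        also have "\<dots> = (\<Sum>l\<le>brank A. if int l = k then X (component k \<omega>) p vs else 0)"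
          using forms_degD(2)[OF deg, of vs _ p] eq by (intro sum.cong refl) auto
        also have "\<dots> = X (component k \<omega>) p vs"
        proof (cases "0 \<le> k \<and> k \<le> int (brank A)")
          case True
          then obtain m where "k = int m" "m \<le> brank A" by (metis nonneg_int_cases of_nat_le_iff)
          then show ?thesis by simp
        next
          case False
          \<comment> \<open>Degree \<open>k\<close> does not occur in the sum, so the claimed value
            has to be 0.\<close>
          have "component k \<omega> = 0"
            using False forms_deg_negative forms_deg_above_rank component_in_forms_deg[OF True, of k]
            by (meson not_le)
          then have "X (component k \<omega>) = 0" by (simp only: vector_field_zero[OF assms])
          then have "X (component k \<omega>) p vs = 0" by (simp only: zero_fun_apply)
          then show ?thesis by (simp only: if_cancel sum.neutral_const)
        qed
        finally show ?thesis using eq by simp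
      qed (simp add: forms_degD(2)[OF deg])
    qed
    show ?thesis using True by (auto simp: op_component_def fun_eq_iff comp)
  qed (simp add: op_component_def vector_fieldsD(1)[OF assms])
qed

text \<open>The double sum over degrees collapses to the summand at \<open>i\<close> and
  \<open>j\<close>. If that one is out of range, one of the two fields is 0 and so is the right-hand
  side.\<close>

lemma bracket_apply:
  assumes X: "X \<in> vector_fields A i" and Y: "Y \<in> vector_fields A j"
  shows "bracket A X Y \<omega> = X (Y \<omega>) + fscale (- ((-1) powi (i * j))) (Y (X \<omega>))"
proof -
  define r where "r = int (brank A)"
  define Z where "Z = (\<lambda>\<omega>. X (Y \<omega>) + fscale (- ((-1) powi (i * j))) (Y (X \<omega>)))"
  note zero = vector_field_zero[OF X] vector_field_zero[OF Y]
  have "(\<lambda>\<omega> p vs. op_component A i' X (op_component A j' Y \<omega>) p vs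
        - (-1) powi (i' * j') * op_component A j' Y (op_component A i' X \<omega>) p vs) =
      (if i' = i then if j' = j then Z else 0 else 0)" for i' j'
    by (auto simp: fun_eq_iff op_component_homogeneous[OF X] op_component_homogeneous[OF Y] Z_def
        zero)
  then have "bracket A X Y = (\<Sum>i'\<in>{-r..r}. \<Sum>j'\<in>{-r..r}. if i' = i then if j' = j then Z else 0 else 0)"
    by (simp only: bracket_def Let_def r_def)
  also have "\<dots> = (\<Sum>i'\<in>{-r..r}. if i' = i then if j \<in> {-r..r} then Z else 0 else 0)"
    by (intro sum.cong refl) (simp add: sum.delta del: sum.neutral_const)
  also have "\<dots> = (if i \<in> {-r..r} \<and> j \<in> {-r..r} then Z else 0)"
    by (simp add: sum.delta)
  also have "\<dots> = Z"
  proof (cases "i \<in> {-r..r} \<and> j \<in> {-r..r}")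
    case False
    then have "X = 0 \<or> Y = 0"
      using vector_field_large_degree[OF X] vector_field_large_degree[OF Y] unfolding r_def by force
    then have "Z \<omega> = 0" for \<omega>
      by (auto simp only: Z_def zero zero_fun_apply fscale_zero add_0_left)
    then have "Z = 0" by (simp add: fun_eq_iff)
    then show ?thesis by (simp only: if_cancel)
  qed simp
  finally show ?thesis by (simp add: Z_def)
qed

lemma bracket_add_left:
  assumes "X \<in> additive_operators" "X' \<in> additive_operators" "Y \<in> additive_operators"
  shows "bracket A (X + X') Y = bracket A X Y + bracket A X' Y"
proof -
  have "(\<lambda>\<omega> p vs. op_component A i (X + X') (op_component A j Y \<omega>) p vs
        - (-1) powi (i * j) * op_component A j Y (op_component A i (X + X') \<omega>) p vs) =
      (\<lambda>\<omega> p vs. op_component A i X (op_component A j Y \<omega>) p vs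
        - (-1) powi (i * j) * op_component A j Y (op_component A i X \<omega>) p vs) +
      (\<lambda>\<omega> p vs. op_component A i X' (op_component A j Y \<omega>) p vs
        - (-1) powi (i * j) * op_component A j Y (op_component A i X' \<omega>) p vs)" for i j
    by (simp add: fun_eq_iff op_component_plus op_component_add op_component_in_forms assms algebra_simps)
  then show ?thesis by (simp only: bracket_def Let_def sum.distrib)
qed

lemma bracket_add_right:
  assumes "X \<in> additive_operators" "Y \<in> additive_operators" "Y' \<in> additive_operators"
  shows "bracket A X (Y + Y') = bracket A X Y + bracket A X Y'"
proof -
  have "(\<lambda>\<omega> p vs. op_component A i X (op_component A j (Y + Y') \<omega>) p vs
        - (-1) powi (i * j) * op_component A j (Y + Y') (op_component A i X \<omega>) p vs) =
      (\<lambda>\<omega> p vs. op_component A i X (op_component A j Y \<omega>) p vs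
        - (-1) powi (i * j) * op_component A j Y (op_component A i X \<omega>) p vs) +
      (\<lambda>\<omega> p vs. op_component A i X (op_component A j Y' \<omega>) p vs
        - (-1) powi (i * j) * op_component A j Y' (op_component A i X \<omega>) p vs)" for i j
    by (simp add: fun_eq_iff op_component_plus op_component_add op_component_in_forms assms algebra_simps)
  then show ?thesis by (simp only: bracket_def Let_def sum.distrib)
qed

lemma bracket_zero_left: "Y \<in> additive_operators \<Longrightarrow> bracket A 0 Y = 0"
  using bracket_add_left[OF zero_additive_operator zero_additive_operator] by (metis add_0 add_cancel_right_left)

lemma bracket_zero_right: "X \<in> additive_operators \<Longrightarrow> bracket A X 0 = 0"
  using bracket_add_right[OF _ zero_additive_operator zero_additive_operator] by (metis add_0 add_cancel_right_left)

section \<open>Derivation properties of the bracket\<close>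

lemma minus_one_powi_square: "(-1 :: real) powi n * (-1) powi n = 1"
  by (simp flip: power_int_mult_distrib)

lemma bracket_vector_field:
  assumes X: "X \<in> vector_fields A i" and Y: "Y \<in> vector_fields A j"
  shows "bracket A X Y \<in> vector_fields A (i + j)"
proof (rule vector_fieldsI)
  note br = bracket_apply[OF X Y]
  note fX = vector_field_in_forms[OF X] and fY = vector_field_in_forms[OF Y]
  show "bracket A X Y \<omega> = 0" if "\<omega> \<notin> forms A" for \<omega>
    using that by (simp add: br vector_fieldsD(1)[OF X] vector_fieldsD(1)[OF Y]
        vector_field_zero[OF X] vector_field_zero[OF Y])
  show "bracket A X Y (\<alpha> + \<beta>) = bracket A X Y \<alpha> + bracket A X Y \<beta>"
    if "\<alpha> \<in> forms A" "\<beta> \<in> forms A" for \<alpha> \<beta>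
    using that by (simp add: br vector_fieldsD(2)[OF X] vector_fieldsD(2)[OF Y] fX fY fscale_add)
  show "bracket A X Y (fscale c \<alpha>) = fscale c (bracket A X Y \<alpha>)" if "\<alpha> \<in> forms A" for \<alpha> c
    using that by (simp add: br vector_fieldsD(3)[OF X] vector_fieldsD(3)[OF Y] fX fY fscale_add mult.commute)
  show "bracket A X Y \<alpha> \<in> forms_deg A (k + (i + j))" if "\<alpha> \<in> forms_deg A k" for \<alpha> k
  proof -
    have "X (Y \<alpha>) \<in> forms_deg A (k + (i + j))"
      using vector_fieldsD(4)[OF X vector_fieldsD(4)[OF Y that]] by (simp add: ac_simps)
    moreover have "Y (X \<alpha>) \<in> forms_deg A (k + (i + j))"
      using vector_fieldsD(4)[OF Y vector_fieldsD(4)[OF X that]] by (simp add: ac_simps)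
    ultimately show ?thesis by (simp add: br forms_deg_add forms_deg_fscale)
  qed
  fix \<alpha> k \<beta> assume \<alpha>: "\<alpha> \<in> forms_deg A k" and \<beta>: "\<beta> \<in> forms A"
  have \<alpha>': "\<alpha> \<in> forms A" using \<alpha> by (rule forms_degD)
  \<comment> \<open>The signs of moving \<open>X\<close> past \<alpha>, \<open>Y\<close> past
    \<alpha>, and \<open>X\<close> past \<open>Y\<close>. In the commutator the mixed products
    cancel because \<open>e\<close> squares to 1.\<close>
  define a b e where "a = (-1 :: real) powi (i * k)" and "b = (-1 :: real) powi (j * k)"
    and "e = (-1 :: real) powi (i * j)"
  have signs: "(-1) powi (i * (k + j)) = a * e" "(-1) powi (j * (k + i)) = b * e"
    "(-1) powi ((i + j) * k) = a * b"
    by (simp_all add: a_def b_def e_def power_int_add algebra_simps)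
  have ee: "e * (e * t) = t" for t
    using minus_one_powi_square[of "i * j"] by (simp add: e_def flip: mult.assoc)
  have XY: "X (Y (wedge \<alpha> \<beta>)) = wedge (X (Y \<alpha>)) \<beta> + fscale (a * e) (wedge (Y \<alpha>) (X \<beta>)) +
      fscale b (wedge (X \<alpha>) (Y \<beta>) + fscale a (wedge \<alpha> (X (Y \<beta>))))"
    using vector_fieldsD(5)[OF Y \<alpha> \<beta>] vector_fieldsD(5)[OF X vector_fieldsD(4)[OF Y \<alpha>] \<beta>]
      vector_fieldsD(5)[OF X \<alpha> fY] \<alpha>' \<beta> fX fY
    by (simp add: vector_fieldsD(2,3)[OF X] forms_wedge forms_fscale signs flip: a_def b_def)
  have YX: "Y (X (wedge \<alpha> \<beta>)) = wedge (Y (X \<alpha>)) \<beta> + fscale (b * e) (wedge (X \<alpha>) (Y \<beta>)) +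
      fscale a (wedge (Y \<alpha>) (X \<beta>) + fscale b (wedge \<alpha> (Y (X \<beta>))))"
    using vector_fieldsD(5)[OF X \<alpha> \<beta>] vector_fieldsD(5)[OF Y vector_fieldsD(4)[OF X \<alpha>] \<beta>]
      vector_fieldsD(5)[OF Y \<alpha> fX] \<alpha>' \<beta> fX fY
    by (simp add: vector_fieldsD(2,3)[OF Y] forms_wedge forms_fscale signs flip: a_def b_def)
  show "bracket A X Y (wedge \<alpha> \<beta>) = wedge (bracket A X Y \<alpha>) \<beta> +
      fscale ((-1) powi ((i + j) * k)) (wedge \<alpha> (bracket A X Y \<beta>))"
    unfolding br XY YX signs wedge_add_left wedge_add_right wedge_fscale_left wedge_fscale_right
    by (simp add: fun_eq_iff algebra_simps ee flip: e_def)
qed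

lemma wedge_vector_field:
  assumes f: "f \<in> forms_deg A k" and X: "X \<in> vector_fields A d"
  shows "(\<lambda>\<omega>. wedge f (X \<omega>)) \<in> vector_fields A (k + d)"
proof (rule vector_fieldsI)
  show "wedge f (X \<alpha>) \<in> forms_deg A (l + (k + d))" if "\<alpha> \<in> forms_deg A l" for \<alpha> l
    using forms_deg_wedge[OF f vector_fieldsD(4)[OF X that]] by (simp add: ac_simps)
  fix \<alpha> l \<beta> assume \<alpha>: "\<alpha> \<in> forms_deg A l" and \<beta>: "\<beta> \<in> forms A"
  have "wedge f (wedge \<alpha> (X \<beta>)) = fscale ((-1) powi (k * l)) (wedge \<alpha> (wedge f (X \<beta>)))"
    unfolding wedge_assoc[symmetric] wedge_graded_commute[OF f \<alpha>] wedge_fscale_left ..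
  moreover have "(-1 :: real) powi ((k + d) * l) = (-1) powi (d * l) * (-1) powi (k * l)"
    by (simp add: power_int_add distrib_right)
  ultimately show "wedge f (X (wedge \<alpha> \<beta>)) = wedge (wedge f (X \<alpha>)) \<beta> +
      fscale ((-1) powi ((k + d) * l)) (wedge \<alpha> (wedge f (X \<beta>)))"
    by (simp add: vector_fieldsD(5)[OF X \<alpha> \<beta>] wedge_add_right wedge_fscale_right wedge_assoc)
qed (simp_all add: vector_fieldsD[OF X] wedge_add_right wedge_fscale_right)

text \<open>Leibniz rule in the second argument. Its terms are multiples of \<open>X\<close> and of
  \<open>bracket A Z X\<close>, which reduces closure of a span to its generators.\<close>

lemma bracket_wedge:
  assumes Z: "Z \<in> vector_fields A z" and f: "f \<in> forms_deg A k" and X: "X \<in> vector_fields A d"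
  shows "bracket A Z (\<lambda>\<omega>. wedge f (X \<omega>)) =
    (\<lambda>\<omega>. wedge (Z f) (X \<omega>)) + (\<lambda>\<omega>. wedge (fscale ((-1) powi (z * k)) f) (bracket A Z X \<omega>))"
proof
  fix \<omega>
  show "bracket A Z (\<lambda>\<omega>. wedge f (X \<omega>)) \<omega> =
    ((\<lambda>\<omega>. wedge (Z f) (X \<omega>)) + (\<lambda>\<omega>. wedge (fscale ((-1) powi (z * k)) f) (bracket A Z X \<omega>))) \<omega>"
    using vector_fieldsD(5)[OF Z f vector_field_in_forms[OF X], of \<omega>]
    by (simp add: bracket_apply[OF Z wedge_vector_field[OF f X]] bracket_apply[OF Z X]
        wedge_add_right wedge_fscale_left wedge_fscale_right fscale_add power_int_add distrib_left
        add.assoc mult.commute[of "(-1) powi (z * d)"])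
qed

lemma bracket_antisymmetric:
  assumes X: "X \<in> vector_fields A i" and Y: "Y \<in> vector_fields A j"
  shows "bracket A Y X = (\<lambda>\<omega>. fscale (- ((-1) powi (i * j))) (bracket A X Y \<omega>))"
  using minus_one_powi_square[of "i * j"]
  by (simp add: fun_eq_iff bracket_apply[OF X Y] bracket_apply[OF Y X] fscale_add mult.commute[of j]
      algebra_simps flip: mult.assoc)

text \<open>Induction on the degree of the form: near each point, \<open>local_decomposition\<close>
  gives products whose factors are killed by \<open>X\<close>, one for reasons of degree and the
  other by induction.\<close>

lemma vector_field_degree_below_minus_one:
  assumes X: "X \<in> vector_fields A d" and d: "d < -1"
  shows "X = 0"
proof -
  have "X \<omega> = 0" if "\<omega> \<in> forms_deg A (int n)" for n \<omega>
    using that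
  proof (induction n arbitrary: \<omega>)
    case 0
    then show ?case using forms_deg_negative[OF vector_fieldsD(4)[OF X 0]] d by simp
  next
    case (Suc n)
    let ?k = "int (Suc n)"
    have "X \<omega> p vs = 0" for p vs
    proof (cases "p \<in> topspace (base A)")
      case True
      obtain U e where Ue: "(U, e) \<in> frames A" "p \<in> U" using frame_at[OF True] .
      obtain h K where h: "smooth_fun A (topspace (base A)) h" "h p \<noteq> 0"
        "closedin (base A) K" "K \<subseteq> U" "\<And>q. q \<notin> K \<Longrightarrow> h q = 0"
        by (rule bump_function[OF manifold frame_openin[OF Ue(1)] Ue(2)]) blast
      have K_top: "K \<subseteq> topspace (base A)" using h(3) by (rule closedin_subset)
      obtain \<theta> \<eta> where dec: "\<And>i. i < brank A \<Longrightarrow> \<theta> i \<in> forms_deg A 1"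
        "\<And>i. i < brank A \<Longrightarrow> \<eta> i \<in> forms_deg A (?k - 1)"
        "(\<Sum>i<brank A. wedge (\<theta> i) (\<eta> i)) = fscale (of_int ?k) (wedge (of_fun h) (wedge (of_fun h) \<omega>))"
        using local_decomposition[OF Ue(1) h(3,4,1,5) Suc.prems] by blast
      have hf: "of_fun h \<in> forms_deg A 0"
        using h(1,5) K_top by (intro of_fun_forms_deg) auto
      have \<omega>: "\<omega> \<in> forms A" using Suc.prems by (rule forms_degD)
      \<comment> \<open>\<open>X\<close> is linear over functions: \<open>X (of_fun h)\<close> has
        negative degree and is therefore 0.\<close>
      have mult: "X (wedge (of_fun h) \<alpha>) = wedge (of_fun h) (X \<alpha>)" if "\<alpha> \<in> forms A" for \<alpha>
        using vector_fieldsD(5)[OF X hf that] forms_deg_negative[OF vector_fieldsD(4)[OF X hf]] d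
        by simp
      have "X (wedge (\<theta> i) (\<eta> i)) = 0" if i: "i < brank A" for i
      proof -
        have "\<eta> i \<in> forms_deg A (int n)" using dec(2)[OF i] by simp
        then have "X (\<eta> i) = 0" by (rule Suc.IH)
        \<comment> \<open>Here \<open>d < -1\<close> is decisive: for \<open>d = -1\<close> a 1-form
          could go to a nonzero function.\<close>
        moreover have "X (\<theta> i) = 0"
          using forms_deg_negative[OF vector_fieldsD(4)[OF X dec(1)[OF i]]] d by simp
        ultimately show ?thesis
          unfolding vector_fieldsD(5)[OF X dec(1)[OF i] forms_degD(1)[OF dec(2)[OF i]]]
          by (simp only: wedge_zero_left wedge_zero_right fscale_zero add_0_left)
      qed
      moreover have "X (\<Sum>i<brank A. wedge (\<theta> i) (\<eta> i)) = (\<Sum>i<brank A. X (wedge (\<theta> i) (\<eta> i)))"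
        using dec(1,2) by (intro vector_field_sum[OF X] forms_wedge) (auto intro: forms_degD(1))
      ultimately have "X (fscale (of_int ?k) (wedge (of_fun h) (wedge (of_fun h) \<omega>))) = 0"
        unfolding dec(3)[symmetric] by (simp add: sum.neutral)
      then have "fscale (of_int ?k) (wedge (of_fun h) (wedge (of_fun h) (X \<omega>))) = 0"
        using \<omega> forms_degD(1)[OF hf] by (simp add: vector_fieldsD(3)[OF X] mult forms_wedge)
      \<comment> \<open>Both \<open>h p\<close> and the factor \<open>n + 1\<close> are nonzero, so
        the value of \<open>X \<omega>\<close> at \<open>p\<close> can be read off.\<close>
      then have "of_int ?k * (h p * (h p * X \<omega> p vs)) = 0"
        by (auto simp: fun_eq_iff wedge_of_fun)
      then show ?thesis using h(2) by simp
    qed (simp add: formsD(1)[OF vector_field_in_forms[OF X]])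
    then show ?case by (simp add: fun_eq_iff)
  qed
  then show ?thesis by (intro vector_field_eq_zeroI[OF X]) blast
qed

section \<open>Spans over the algebra of forms\<close>

lemma module_span_add:
  "X \<in> module_span A S \<Longrightarrow> Y \<in> module_span A S \<Longrightarrow> X + Y \<in> module_span A S"
  by (induction rule: module_span.induct) (auto simp: add.assoc intro: module_span.intros)

lemma module_span_wedge:
  assumes "f \<in> forms A"
  shows "X \<in> module_span A S \<Longrightarrow> (\<lambda>\<omega>. wedge f (X \<omega>)) \<in> module_span A S"
proof (induction rule: module_span.induct)
  case zero
  have "(\<lambda>\<omega>. wedge f ((0 :: ('m, 'a) operator) \<omega>)) = 0" by (simp add: fun_eq_iff)
  then show ?case by (simp only: module_span.zero)
next
  case (step g X Y)
  have "(\<lambda>\<omega>. wedge (wedge f g) (X \<omega>)) + (\<lambda>\<omega>. wedge f (Y \<omega>)) \<in> module_span A S"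
    using step assms by (intro module_span.step forms_wedge)
  then show ?case by (simp add: plus_fun_def wedge_add_right[unfolded plus_fun_def] wedge_assoc)
qed

lemma module_span_fscale: "X \<in> module_span A S \<Longrightarrow> (\<lambda>\<omega>. fscale c (X \<omega>)) \<in> module_span A S"
proof (induction rule: module_span.induct)
  case zero
  have "(\<lambda>\<omega>. fscale c ((0 :: ('m, 'a) operator) \<omega>)) = 0" by (simp add: fun_eq_iff)
  then show ?case by (simp only: module_span.zero)
next
  case (step g X Y)
  have "(\<lambda>\<omega>. wedge (fscale c g) (X \<omega>)) + (\<lambda>\<omega>. fscale c (Y \<omega>)) \<in> module_span A S"
    using step by (intro module_span.step forms_fscale)
  moreover have "(\<lambda>\<omega>. wedge (fscale c g) (X \<omega>)) + (\<lambda>\<omega>. fscale c (Y \<omega>)) =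
      (\<lambda>\<omega>. fscale c (((\<lambda>\<omega>. wedge g (X \<omega>)) + Y) \<omega>))"
    by (rule ext) (simp add: wedge_fscale_left fscale_add)
  ultimately show ?case by (simp only:)
qed

lemma module_span_diff:
  assumes "X \<in> module_span A S" "Y \<in> module_span A S"
  shows "X - Y \<in> module_span A S"
proof -
  have "X - Y = X + (\<lambda>\<omega>. fscale (-1) (Y \<omega>))" by (simp add: fun_eq_iff)
  then show ?thesis using assms by (simp only: module_span_add module_span_fscale)
qed

text \<open>Spans are built from products with forms; the product with the unit recovers
  \<open>X\<close>, provided the values of \<open>X\<close> are forms.\<close>

lemma module_span_generator:
  assumes "X \<in> S" "X \<in> additive_operators"
  shows "X \<in> module_span A S"
proof -
  have "(\<lambda>\<omega>. wedge one_form (X \<omega>)) + 0 \<in> module_span A S"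
    using assms one_form_forms_deg forms_degD(1) by (intro module_span.intros) blast+
  then show ?thesis using assms(2) by (simp add: wedge_one_form additive_operatorsD(1))
qed

lemma module_span_subset: "S \<subseteq> module_span A T \<Longrightarrow> module_span A S \<subseteq> module_span A T"
proof
  fix X assume S: "S \<subseteq> module_span A T" and "X \<in> module_span A S"
  from this(2) show "X \<in> module_span A T"
  proof (induction rule: module_span.induct)
    case (step f X Y)
    then show ?case using S by (intro module_span_add module_span_wedge) auto
  qed (rule module_span.zero)
qed

lemma module_span_additive_operators:
  assumes S: "S \<subseteq> additive_operators" and "X \<in> module_span A S"
  shows "X \<in> additive_operators"
  using assms(2)
proof (induction rule: module_span.induct)
  case (step f X Y)
  then show ?case using S by (intro additive_operators_add additive_operators_wedge) auto
qed (rule zero_additive_operator)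

text \<open>The homogeneous components of each coefficient are added one at a time, because the
  Leibniz rule needs the degree of the coefficient.\<close>

lemma module_span_homogeneous_induct [consumes 1, case_names zero step]:
  assumes "X \<in> module_span A S" and "P 0"
    and step: "\<And>k f X Y. f \<in> forms_deg A k \<Longrightarrow> X \<in> S \<Longrightarrow> Y \<in> module_span A S \<Longrightarrow> P Y \<Longrightarrow>
      P ((\<lambda>\<omega>. wedge f (X \<omega>)) + Y)"
  shows "P X"
  using assms(1)
proof (induction rule: module_span.induct)
  case (step f X Y)
  let ?f = "\<lambda>n. \<Sum>k<n. component (int k) f"
  have "P ((\<lambda>\<omega>. wedge (?f n) (X \<omega>)) + Y) \<and>
      (\<lambda>\<omega>. wedge (?f n) (X \<omega>)) + Y \<in> module_span A S" for n
  proof (induction n)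
    case 0
    have eq: "(\<lambda>\<omega>. wedge (?f 0) (X \<omega>)) + Y = Y"
      by (rule ext) (simp only: plus_fun_apply lessThan_0 sum.empty wedge_zero_left add_0_left)
    show ?case unfolding eq using step by blast
  next
    case (Suc n)
    have eq: "(\<lambda>\<omega>. wedge (?f (Suc n)) (X \<omega>)) + Y =
        (\<lambda>\<omega>. wedge (component (int n) f) (X \<omega>)) + ((\<lambda>\<omega>. wedge (?f n) (X \<omega>)) + Y)"
      by (rule ext) (simp only: plus_fun_apply sum.lessThan_Suc wedge_add_left ac_simps)
    show ?case
      unfolding eq
      using Suc.IH step.hyps assms(3)[OF component_in_forms_deg] forms_component
      by (blast intro: module_span.step)
  qed
  moreover have "?f (Suc (brank A)) = f"
    using forms_eq_sum_components[OF step.hyps(1)] by (simp only: lessThan_Suc_atMost)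
  ultimately show ?case by metis
qed (rule assms(2))

text \<open>In the Leibniz rule, the term with \<open>Z f\<close> is a multiple of a generator and
  the other term a multiple of \<open>bracket A Z X\<close>.\<close>

lemma bracket_module_span:
  assumes Z: "Z \<in> vector_fields A z" and S: "\<And>X. X \<in> S \<Longrightarrow> \<exists>d. X \<in> vector_fields A d"
    and br: "\<And>X. X \<in> S \<Longrightarrow> bracket A Z X \<in> module_span A S"
    and Y: "Y \<in> module_span A S"
  shows "bracket A Z Y \<in> module_span A S"
  using Y
proof (induction rule: module_span_homogeneous_induct)
  case zero
  show ?case by (simp only: bracket_zero_right[OF vector_field_additive[OF Z]] module_span.zero)
next
  case (step k f X Y)
  obtain d where X: "X \<in> vector_fields A d" using S step by blast
  have fX: "(\<lambda>\<omega>. wedge f (X \<omega>)) \<in> additive_operators"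
    by (rule vector_field_additive[OF wedge_vector_field[OF step(1) X]])
  have "S \<subseteq> additive_operators" using S vector_field_additive by blast
  then have Y: "Y \<in> additive_operators" using module_span_additive_operators step by blast
  have "(\<lambda>\<omega>. wedge (Z f) (X \<omega>)) \<in> module_span A S"
    using vector_field_in_forms[OF Z] step(2) vector_field_additive[OF X]
    by (intro module_span_wedge module_span_generator)
  moreover have "(\<lambda>\<omega>. wedge (fscale ((-1) powi (z * k)) f) (bracket A Z X \<omega>)) \<in> module_span A S"
    using step br forms_degD(1) by (intro module_span_wedge forms_fscale) blast+
  ultimately have "bracket A Z (\<lambda>\<omega>. wedge f (X \<omega>)) \<in> module_span A S"
    unfolding bracket_wedge[OF Z step(1) X] by (rule module_span_add)
  then show ?case
    unfolding bracket_add_right[OF vector_field_additive[OF Z] fX Y] using step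
    by (intro module_span_add)
qed

text \<open>The Leibniz rule treats coefficients of the right argument; antisymmetry reduces those
  of the left argument to this case.\<close>

lemma involutive_module_span:
  assumes S: "\<And>X. X \<in> S \<Longrightarrow> \<exists>d. X \<in> vector_fields A d"
    and br: "\<And>X Y. X \<in> S \<Longrightarrow> Y \<in> S \<Longrightarrow> bracket A X Y \<in> module_span A S"
  shows "involutive A (module_span A S)"
  unfolding involutive_def
proof (intro ballI)
  fix X Y assume X: "X \<in> module_span A S" and Y: "Y \<in> module_span A S"
  have sub: "S \<subseteq> additive_operators" using S vector_field_additive by blast
  have Y': "Y \<in> additive_operators" using module_span_additive_operators[OF sub Y] .
  show "bracket A X Y \<in> module_span A S"
    using X
  proof (induction rule: module_span_homogeneous_induct)
    case zero
    show ?case by (simp only: bracket_zero_left[OF Y'] module_span.zero)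
  next
    case (step k f X X')
    obtain d where X: "X \<in> vector_fields A d" using S step by blast
    note fX = wedge_vector_field[OF step(1) X]
    have span: "(\<lambda>\<omega>. wedge f (X \<omega>)) \<in> module_span A S"
      using step forms_degD(1) vector_field_additive[OF X]
      by (intro module_span_wedge module_span_generator) blast+
    \<comment> \<open>Against a generator \<open>W\<close>: exchange the arguments, use closure
      under the bracket with \<open>W\<close>, and exchange back.\<close>
    have "bracket A (\<lambda>\<omega>. wedge f (X \<omega>)) W \<in> module_span A S" if W: "W \<in> S" for W
    proof -
      obtain w where W': "W \<in> vector_fields A w" using S W by blast
      have "bracket A W (\<lambda>\<omega>. wedge f (X \<omega>)) \<in> module_span A S"
        using bracket_module_span[OF W' S br[OF W] span] .
      then show ?thesis
        unfolding bracket_antisymmetric[OF W' fX] by (rule module_span_fscale)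
    qed
    then have "bracket A (\<lambda>\<omega>. wedge f (X \<omega>)) Y \<in> module_span A S"
      using bracket_module_span[OF fX S _ Y] by blast
    moreover have "X' \<in> additive_operators" using module_span_additive_operators[OF sub] step by blast
    ultimately show ?case
      unfolding bracket_add_left[OF vector_field_additive[OF fX] \<open>X' \<in> additive_operators\<close> Y']
      using step by (intro module_span_add)
  qed
qed

text \<open>The bracket of \<open>Q\<close> with itself is twice the square of \<open>Q\<close>, so
  \<open>Q\<close> squares to 0; in the iterated bracket the two terms \<open>Q Y Q\<close>
  cancel.\<close>

lemma homological_bracket_twice:
  assumes Q: "Q \<in> vector_fields A 1" "bracket A Q Q = 0" and Y: "Y \<in> vector_fields A j"
  shows "bracket A Q (bracket A Q Y) = 0"
proof
  have QQ: "Q (Q \<omega>) = 0" for \<omega>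
  proof -
    have "bracket A Q Q \<omega> = 0" using Q(2) by simp
    then have "Q (Q \<omega>) + Q (Q \<omega>) = 0" by (simp add: bracket_apply[OF Q(1,1)])
    then show ?thesis by (simp add: fun_eq_iff)
  qed
  note mem = vector_field_in_forms[OF Q(1)] vector_field_in_forms[OF Y]
  show "bracket A Q (bracket A Q Y) \<omega> = 0 \<omega>" for \<omega>
    by (simp add: bracket_apply[OF Q(1) bracket_vector_field[OF Q(1) Y]] bracket_apply[OF Q(1) Y]
        vector_fieldsD(2,3)[OF Q(1)] mem forms_fscale QQ vector_field_zero[OF Y] power_int_add
        distrib_left)
      (simp add: fun_eq_iff)
qed

text \<open>The graded Jacobi identity with one term gone. As \<open>X\<close> has degree 0, the
  assumption says that \<open>X\<close> and \<open>Q\<close> commute as operators, and both sides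
  can be expanded.\<close>

lemma bracket_commute_invariant:
  assumes Q: "Q \<in> vector_fields A 1" and X: "X \<in> vector_fields A 0" and QX: "bracket A Q X = 0"
    and Y: "Y \<in> vector_fields A j"
  shows "bracket A X (bracket A Q Y) = bracket A Q (bracket A X Y)"
proof
  have comm: "Q (X \<omega>) = X (Q \<omega>)" for \<omega>
  proof -
    have "bracket A Q X \<omega> = 0" using QX by simp
    then have "Q (X \<omega>) + fscale (- 1) (X (Q \<omega>)) = 0" by (simp add: bracket_apply[OF Q X])
    then show ?thesis by (simp add: fun_eq_iff)
  qed
  note mem = vector_field_in_forms[OF Q(1)] vector_field_in_forms[OF X] vector_field_in_forms[OF Y]
  show "bracket A X (bracket A Q Y) \<omega> = bracket A Q (bracket A X Y) \<omega>" for \<omega>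
    by (simp add: bracket_apply[OF X bracket_vector_field[OF Q Y]] bracket_apply[OF Q Y]
        bracket_apply[OF Q bracket_vector_field[OF X Y]] bracket_apply[OF X Y]
        vector_fieldsD(2,3)[OF Q] vector_fieldsD(2,3)[OF X] mem forms_fscale comm)
      (simp add: fun_eq_iff algebra_simps)
qed

end

section \<open>The distribution of an action\<close>

lemma strict_Lie_2_algebra_decompose:
  assumes "strict_Lie_2_algebra L"
  obtains w x\<^sub>0 where "w \<in> grade L (-1)" "x\<^sub>0 \<in> grade L 0" "x = w + x\<^sub>0"
proof -
  have "\<forall>x. \<exists>!c. (\<forall>i. c i \<in> grade L i) \<and> finite {i. c i \<noteq> 0} \<and> x = (\<Sum>i | c i \<noteq> 0. c i)"
    using assms unfolding strict_Lie_2_algebra_def DGLA_def by (elim conjE)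
  from ex1_implies_ex[OF spec[OF this, of x]]
  obtain c where c: "\<And>i. c i \<in> grade L i" "finite {i. c i \<noteq> 0}" "x = (\<Sum>i | c i \<noteq> 0. c i)"
    by blast
  have "c i = 0" if "i \<noteq> -1 \<and> i \<noteq> 0" for i
    using c(1)[of i] assms that unfolding strict_Lie_2_algebra_def by auto
  then have "(\<Sum>i | c i \<noteq> 0. c i) = (\<Sum>i\<in>{-1, 0}. c i)"
    by (intro sum.mono_neutral_left) auto
  then have "x = c (-1) + c 0" using c(3) by simp
  then show ?thesis using that c(1) by blast
qed

theorem proposition3p5:
  fixes A :: "('m, 'e::{real_inner,heine_borel}, 'a::real_vector) vbundle"
    and Q :: "('m, 'a) operator"
    and L :: "'l::real_vector dgla"
    and \<mu> :: "'l \<Rightarrow> ('m, 'a) operator"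
    and \<eta> :: "'l \<Rightarrow> 'l \<Rightarrow> ('m, 'a) operator"
    and D :: "('m, 'a) operator set"
  assumes "strict_Lie_2_algebra L"
    and "vector_bundle A"
    and "NQ1_structure A Q"
    and "action A Q L \<mu> \<eta>"
    and D: "D = distribution A Q L \<mu> \<eta>"
    and "\<forall>X\<in>degree_part A D 0. \<forall>Y\<in>degree_part A D (-1). bracket A X Y \<in> degree_part A D (-1)"
  shows "(\<forall>X\<in>D. bracket A Q X \<in> D) \<and> involutive A D"
proof -
  interpret smooth_vector_bundle A by unfold_locales fact
  have Q: "Q \<in> vector_fields A 1" "bracket A Q Q = 0"
    using assms(3) by (auto simp: NQ1_structure_def)
  have act: "\<forall>x y. \<mu> (x + y) = \<mu> x + \<mu> y"
    "\<forall>x\<in>grade L 0. \<mu> x \<in> vector_fields A 0"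
    "\<forall>w\<in>grade L (-1). \<mu> w \<in> vector_fields A (-1)"
    "\<forall>x\<in>grade L 0. \<forall>y\<in>grade L 0. \<eta> x y \<in> vector_fields A (-1)"
    "\<forall>x. bracket A Q (\<mu> x) = \<mu> (ldiff L x)"
    "\<forall>x\<in>grade L 0. \<forall>y\<in>grade L 0.
      \<mu> (lbr L x y) - bracket A (\<mu> x) (\<mu> y) = bracket A Q (\<eta> x y)"
    using assms(4) unfolding action_def by - (elim conjE, assumption)+
  have \<mu>_add: "\<mu> (x + y) = \<mu> x + \<mu> y" for x y using act(1) by blast
  have \<mu>0: "\<mu> x \<in> vector_fields A 0" if "x \<in> grade L 0" for x using act(2) that by blast
  have \<mu>1: "\<mu> w \<in> vector_fields A (-1)" if "w \<in> grade L (-1)" for w using act(3) that by blast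
  have \<eta>: "\<eta> x y \<in> vector_fields A (-1)" if "x \<in> grade L 0" "y \<in> grade L 0" for x y
    using act(4) that by blast
  have Q\<mu>: "bracket A Q (\<mu> x) = \<mu> (ldiff L x)" for x using act(5) by blast
  have \<mu>\<mu>: "\<mu> (lbr L x y) - bracket A (\<mu> x) (\<mu> y) = bracket A Q (\<eta> x y)"
    if "x \<in> grade L 0" "y \<in> grade L 0" for x y
    using act(6) that by blast
  have Q\<eta>: "bracket A Q (\<eta> x y) \<in> vector_fields A 0" if "x \<in> grade L 0" "y \<in> grade L 0" for x y
    using bracket_vector_field[OF Q(1) \<eta>[OF that]] by simp
  \<comment> \<open>Generators sorted by degree, 0 here and -1 in \<open>G1\<close>. The given
    generators include the values of \<mu> on mixed elements of \<open>L\<close>, which are not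
    homogeneous.\<close>
  define G0 where "G0 = \<mu> ` grade L 0 \<union> {bracket A Q (\<eta> x y) |x y. x \<in> grade L 0 \<and> y \<in> grade L 0}"
  define G1 where "G1 = \<mu> ` grade L (-1) \<union> {\<eta> x y |x y. x \<in> grade L 0 \<and> y \<in> grade L 0}"
  have G0: "X \<in> vector_fields A 0" if "X \<in> G0" for X
    using that \<mu>0 Q\<eta> by (auto simp: G0_def)
  have G1: "X \<in> vector_fields A (-1)" if "X \<in> G1" for X
    using that \<mu>1 \<eta> by (auto simp: G1_def)
  have hom: "\<exists>d. X \<in> vector_fields A d" if "X \<in> G0 \<union> G1" for X
    using that G0 G1 by blast
  have gen: "X \<in> module_span A (G0 \<union> G1)" if "X \<in> G0 \<union> G1" for X
    using that hom[OF that] vector_field_additive by (blast intro: module_span_generator)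
  have \<eta>_span: "\<eta> x y \<in> module_span A (G0 \<union> G1)"
    and Q\<eta>_span: "bracket A Q (\<eta> x y) \<in> module_span A (G0 \<union> G1)"
    if "x \<in> grade L 0" "y \<in> grade L 0" for x y
  proof -
    have "\<eta> x y \<in> G1" using that unfolding G1_def by blast
    then show "\<eta> x y \<in> module_span A (G0 \<union> G1)" by (intro gen UnI2)
    have "bracket A Q (\<eta> x y) \<in> G0" using that unfolding G0_def by blast
    then show "bracket A Q (\<eta> x y) \<in> module_span A (G0 \<union> G1)" by (intro gen UnI1)
  qed
  have \<mu>_span: "\<mu> x \<in> module_span A (G0 \<union> G1)" for x
  proof -
    obtain w x\<^sub>0 where "w \<in> grade L (-1)" "x\<^sub>0 \<in> grade L 0" "x = w + x\<^sub>0"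
      using strict_Lie_2_algebra_decompose[OF assms(1)] .
    then show ?thesis
      unfolding \<open>x = w + x\<^sub>0\<close> \<mu>_add by (intro module_span_add gen) (auto simp: G0_def G1_def)
  qed
  have D_eq: "D = module_span A (G0 \<union> G1)"
    unfolding D distribution_def
  proof (intro equalityI module_span_subset subsetI)
    fix X assume "X \<in> range \<mu> \<union> {\<eta> x y |x y. x \<in> grade L 0 \<and> y \<in> grade L 0}
       \<union> {bracket A Q (\<eta> x y) |x y. x \<in> grade L 0 \<and> y \<in> grade L 0}"
    then show "X \<in> module_span A (G0 \<union> G1)"
      using \<mu>_span \<eta>_span Q\<eta>_span by auto
  next
    fix X assume X: "X \<in> G0 \<union> G1"
    then show "X \<in> module_span A (range \<mu> \<union> {\<eta> x y |x y. x \<in> grade L 0 \<and> y \<in> grade L 0}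
       \<union> {bracket A Q (\<eta> x y) |x y. x \<in> grade L 0 \<and> y \<in> grade L 0})"
      using hom[OF X] vector_field_additive
      by (intro module_span_generator) (auto simp: G0_def G1_def)
  qed
  have QG0: "bracket A Q X = 0" if "X \<in> G0" for X
  proof -
    have "\<mu> 0 = 0" using \<mu>_add[of 0 0] by simp
    moreover have "ldiff L x = 0" if "x \<in> grade L 0" for x
    proof -
      \<comment> \<open>The part of degree 1 of a strict Lie 2-algebra is zero.\<close>
      have "ldiff L x \<in> grade L (0 + 1)"
        using assms(1) that unfolding strict_Lie_2_algebra_def DGLA_def by blast
      then show ?thesis using assms(1) by (simp add: strict_Lie_2_algebra_def)
    qed
    ultimately show ?thesis
      using that Q\<mu> homological_bracket_twice[OF Q \<eta>] by (auto simp: G0_def)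
  qed
  have Q_closed: "bracket A Q X \<in> D" if "X \<in> D" for X
    unfolding D_eq
  proof (rule bracket_module_span[OF Q(1) hom _ that[unfolded D_eq]])
    fix X assume "X \<in> G0 \<union> G1"
    then consider "X \<in> G0" | w where "X = \<mu> w"
      | x y where "X = \<eta> x y" "x \<in> grade L 0" "y \<in> grade L 0"
      by (auto simp: G1_def)
    then show "bracket A Q X \<in> module_span A (G0 \<union> G1)"
    proof cases
      case 1
      then show ?thesis by (simp only: QG0 module_span.zero)
    next
      case 2
      then show ?thesis using Q\<mu> \<mu>_span by simp
    next
      case 3
      then show ?thesis using Q\<eta>_span by simp
    qed
  qed
  \<comment> \<open>The only point at which the hypothesis on brackets of degree 0 with degree -1
    enters; it is applied to generators.\<close>
  have br01: "bracket A X Y \<in> D" if "X \<in> G0" "Y \<in> G1" for X Y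
    using assms(6) that gen G0 G1 unfolding degree_part_def D_eq by blast
  have br_exact: "bracket A X (bracket A Q (\<eta> x y)) \<in> D"
    if "X \<in> G0" "x \<in> grade L 0" "y \<in> grade L 0" for X x y
    unfolding bracket_commute_invariant[OF Q(1) G0[OF that(1)] QG0[OF that(1)] \<eta>[OF that(2,3)]]
    using that by (intro Q_closed br01) (auto simp: G1_def)
  \<comment> \<open>Exchanging the arguments multiplies the bracket by a sign, and \<open>D\<close>
    absorbs real factors.\<close>
  have swap: "bracket A Y X \<in> D" if XY: "bracket A X Y \<in> D" "X \<in> G0 \<union> G1" "Y \<in> G0 \<union> G1" for X Y
  proof -
    obtain i j where ij: "X \<in> vector_fields A i" "Y \<in> vector_fields A j"
      using hom[OF XY(2)] hom[OF XY(3)] by blast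
    show ?thesis
      using XY(1) unfolding D_eq bracket_antisymmetric[OF ij] by (rule module_span_fscale)
  qed
  have br00: "bracket A X Y \<in> D" if X: "X \<in> G0" and Y: "Y \<in> G0" for X Y
  proof -
    consider x y where "Y = bracket A Q (\<eta> x y)" "x \<in> grade L 0" "y \<in> grade L 0"
      | x y where "X = bracket A Q (\<eta> x y)" "x \<in> grade L 0" "y \<in> grade L 0"
      | x y where "X = \<mu> x" "Y = \<mu> y" "x \<in> grade L 0" "y \<in> grade L 0"
      using X Y by (auto simp: G0_def)
    then show ?thesis
    proof cases
      case 1
      then show ?thesis using br_exact[OF X] by simp
    next
      case 2
      then show ?thesis using br_exact[OF Y] swap X Y by simp
    next
      case (3 x y)
      \<comment> \<open>The compatibility of \<mu> with brackets up to \<eta>, solved for the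
        bracket of the two vector fields.\<close>
      have "\<mu> (lbr L x y) - bracket A Q (\<eta> x y) \<in> D"
        unfolding D_eq using 3 by (intro module_span_diff \<mu>_span Q\<eta>_span)
      moreover have "\<mu> (lbr L x y) - bracket A Q (\<eta> x y) = bracket A X Y"
        using \<mu>\<mu>[OF 3(3,4), symmetric] 3 by simp
      ultimately show ?thesis by simp
    qed
  qed
  have br11: "bracket A X Y = 0" if "X \<in> G1" "Y \<in> G1" for X Y
    using bracket_vector_field[OF G1 G1, OF that] by (intro vector_field_degree_below_minus_one) auto
  have "bracket A X Y \<in> D" if "X \<in> G0 \<union> G1" "Y \<in> G0 \<union> G1" for X Y
    using that br00 br01 swap[OF br01] br11 module_span.zero[of A "G0 \<union> G1", folded D_eq] by auto
  then have "involutive A D"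
    unfolding D_eq by (intro involutive_module_span hom)
  then show ?thesis using Q_closed by blast
qed

end
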